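(* Let $\mathcal H$ be a separable Banach space, let $\mathcal P_0$ be a Markov transition kernel on $\mathcal H$, and assume: (3a) $d:\mathcal H\times\mathcal H\to[0,1]$ is a distance-like function; (3b) $\mathcal P_0$ is contracting for $d$: there is $\gamma_1\in(0,1)$ with $d(\mathcal P_0\delta_u,\mathcal P_0\delta_v)\le\gamma_1d(u,v)$ whenever $d(u,v)<1$; (3c) $\mathcal P_0$ has a continuous Lyapunov function $V:\mathcal H\to[0,\infty)$; (3d) for some $\theta>0$, the function $\tilde d(u,v):=[d(u,v)(2+\theta V(u)+\theta V(v))]^{1/2}$ satisfies $\tilde d(u,v)\le G[\tilde d(u,w)+\tilde d(w,v)]$ for all $u,v,w\in\mathcal H$, with a uniform constant $G>0$; (3e) $\mathcal P_0$ has a unique invariant measure $\nu_0\in P^1(\mathcal H;\tilde d)$; (3f) there exist an integer $n_0\ge1$ and $\gamma\in(0,1)$ with $\tilde d(\mathcal P_0^{n_0}\delta_u,\mathcal P_0^{n_0}\delta_v)\le\gamma\tilde d(u,v)$ for all $u,v\in\mathcal H$. Let $\varepsilon_0>0$ and let $(\mathcal P_\varepsilon)_{\varepsilon\in(0,\varepsilon_0)}$ be Markov transition kernels on $\mathcal H$ such that: (4a) for every $\varepsilon\in(0,\varepsilon_0)$ there are $\kappa_\varepsilon\in(0,1)$, $K_\varepsilon\in(0,\infty)$ with $\mathcal P_\varepsilon V(u)\le\kappa_\varepsilon V(u)+K_\varepsilon$ for all $u\in\mathcal H$; (4b) there is a bounded function $\psi:\mathbb R_+\to\mathbb R_+$ with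 $\tilde d(\mathcal P_0\delta_u,\mathcal P_\varepsilon\delta_u)\le\psi(\varepsilon)(1+\sqrt{V(u)})$ for all $u\in\mathcal H$ and $\varepsilon\in(0,\varepsilon_0)$. Let $\mathcal X$ be a separable Hilbert space with norm $\|\cdot\|_{\mathcal X}$, let $u_0\in\mathcal H$, $\varepsilon\in(0,\varepsilon_0)$, and let $(U_k^\varepsilon)_{k\ge0}$ be the Markov chain with transition kernel $\mathcal P_\varepsilon$ and $U_0^\varepsilon=u_0$. Then for any Bochner measurable function $\varphi:\mathcal H\to\mathcal X$ with $|||\varphi|||_{\tilde d}<\infty$: (a) there exist positive constants $C_1,C_2,C_3$, independent of $n$ but depending on $\theta,\kappa_\varepsilon,K_\varepsilon,\gamma$ and $V(u_0)$, such that for all integers $n\ge1$ $$\mathbb E\left\|\frac1n\sum_{k=0}^{n-1}\varphi(U_k^\varepsilon)-\nu_0(\varphi)\right\|_{\mathcal X}\le\frac{|||\varphi|||_{\tilde d}}{1-\gamma}\left(C_1\psi(\varepsilon)+C_2\frac{\psi(\varepsilon)}n+C_3\frac1{\sqrt n}\right);$$ (b) there exist positive constants $C_4,C_5,C_6$, independent of $n$ but depending on $\theta,\kappa_\varepsilon$ and $K_\varepsilon$, such that for all integers $n\ge1$ $$\left\|\mathbb E\,\frac1n\sum_{k=0}^{n-1}\varphi(U_k^\varepsilon)-\nu_0(\varphi)\right\|_{\mathcal X}\le\frac{|||\varphi|||_{\tilde d}}{1-\gamma}\left(C_4\psi(\varepsilon)+C_5\frac{\psi(\varepsilon)}n+\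frac{C_6}n\right).$$
   Context: A function $d:\mathcal H\times\mathcal H\to\mathbb R$ is distance-like if it is nonnegative, symmetric, lower semicontinuous, and $d(u,v)=0$ iff $u=v$. For such $d$ (or for $\tilde d$) and probability measures $\mu_1,\mu_2$ on $\mathcal H$, $d(\mu_1,\mu_2):=\inf_\pi\int d(u,v)\,\pi(du,dv)$ over all couplings $\pi$ of $\mu_1,\mu_2$. $P^1(\mathcal H;\tilde d)$ is the set of Radon probability measures $\mu$ on $\mathcal H$ with $\int\tilde d(u,0)\,\mu(du)<\infty$. $V$ is a Lyapunov function for a Markov kernel $\mathcal P$ if there are $\kappa\in(0,1)$, $K\in(0,\infty)$ with $(\mathcal PV)(u)\le\kappa V(u)+K$ for all $u$. $\mathcal P^k\delta_u$ is the law after $k$ steps of the chain started at $u$. $|||\varphi|||_{\tilde d}:=\sup_{u\ne v}\|\varphi(u)-\varphi(v)\|_{\mathcal X}/\tilde d(u,v)$. Integrals $\nu_0(\varphi)=\int\varphi\,d\nu_0$ and expectations of $\mathcal X$-valued variables are Bochner integrals.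
   Formalization: In (b) the constant C_6 may also depend on V(u_0), since a bound uniform in u_0 fails already for n=1, ψ=0 with unbounded φ; and all constants may depend on the fixed data of P_0 in (3): n_0 and its Lyapunov constants. *)

theory Defs
  imports "HOL-Probability.Probability"
begin

definition lower_semicontinuous :: "('a::topological_space \<Rightarrow> real) \<Rightarrow> bool" where
  "lower_semicontinuous f \<longleftrightarrow> (\<forall>x y. y < f x \<longrightarrow> (\<forall>\<^sub>F z in nhds x. y < f z))"

definition distance_like :: "('h::topological_space \<Rightarrow> 'h \<Rightarrow> real) \<Rightarrow> bool" where
  "distance_like d \<longleftrightarrow>
     (\<forall>u v. 0 \<le> d u v) \<and> (\<forall>u v. d u v = d v u) \<and>
     lower_semicontinuous (\<lambda>(u, v). d u v) \<and> (\<forall>u v. d u v = 0 \<longleftrightarrow> u = v)"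

definition couplings ::
    "'h::topological_space measure \<Rightarrow> 'h measure \<Rightarrow> ('h \<times> 'h) measure set" where
  "couplings \<mu>\<^sub>1 \<mu>\<^sub>2 =
     {\<pi>. prob_space \<pi> \<and> sets \<pi> = sets (borel \<Otimes>\<^sub>M borel) \<and>
          distr \<pi> borel fst = \<mu>\<^sub>1 \<and> distr \<pi> borel snd = \<mu>\<^sub>2}"

(* The extension of d to probability measures; it may take the value \<infinity>. *)
definition wass ::
    "('h::topological_space \<Rightarrow> 'h \<Rightarrow> real) \<Rightarrow> 'h measure \<Rightarrow> 'h measure \<Rightarrow> ennreal" where
  "wass d \<mu>\<^sub>1 \<mu>\<^sub>2 = (INF \<pi>\<in>couplings \<mu>\<^sub>1 \<mu>\<^sub>2. \<integral>\<^sup>+ (u, v). ennreal (d u v) \<partial>\<pi>)"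

definition dtilde :: "('h \<Rightarrow> 'h \<Rightarrow> real) \<Rightarrow> ('h \<Rightarrow> real) \<Rightarrow> real \<Rightarrow> 'h \<Rightarrow> 'h \<Rightarrow> real" where
  "dtilde d V \<theta> u v = sqrt (d u v * (2 + \<theta> * V u + \<theta> * V v))"

definition radon_prob :: "'h::topological_space measure \<Rightarrow> bool" where
  "radon_prob \<mu> \<longleftrightarrow>
     prob_space \<mu> \<and> sets \<mu> = sets borel \<and>
     (\<forall>A\<in>sets borel. emeasure \<mu> A = (SUP K\<in>{K. K \<subseteq> A \<and> compact K}. emeasure \<mu> K))"

definition P1 ::
    "('h::{topological_space, zero} \<Rightarrow> 'h \<Rightarrow> real) \<Rightarrow> 'h measure set" where
  "P1 d = {\<mu>. radon_prob \<mu> \<and> (\<integral>\<^sup>+ u. ennreal (d u 0) \<partial>\<mu>) < \<infinity>}"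

definition markov_kernel :: "('h::topological_space \<Rightarrow> 'h measure) \<Rightarrow> bool" where
  "markov_kernel P \<longleftrightarrow> P \<in> measurable borel (prob_algebra borel)"

primrec kernel_iter ::
    "('h::topological_space \<Rightarrow> 'h measure) \<Rightarrow> nat \<Rightarrow> 'h \<Rightarrow> 'h measure" where
  "kernel_iter P 0 u = return borel u"
| "kernel_iter P (Suc k) u = bind (kernel_iter P k u) P"

definition invariant_measure ::
    "('h::topological_space \<Rightarrow> 'h measure) \<Rightarrow> 'h measure \<Rightarrow> bool" where
  "invariant_measure P \<nu> \<longleftrightarrow> bind \<nu> P = \<nu>"

(* Stated with the extended nonnegative integral, so that finiteness of P V is part of
   the condition. *)
definition lyapunov_bound ::
    "('h \<Rightarrow> 'h measure) \<Rightarrow> ('h \<Rightarrow> real) \<Rightarrow> real \<Rightarrow> real \<Rightarrow> bool" where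
  "lyapunov_bound P V \<kappa> K \<longleftrightarrow>
     0 < \<kappa> \<and> \<kappa> < 1 \<and> 0 < K \<and>
     (\<forall>u. (\<integral>\<^sup>+ v. ennreal (V v) \<partial>P u) \<le> ennreal (\<kappa> * V u + K))"

(* Valued in ennreal so that the supremum over the empty set is 0 when the space is trivial
   and \<infinity> when the quotients are unbounded. *)
definition lip_norm ::
    "('h \<Rightarrow> 'h \<Rightarrow> real) \<Rightarrow> ('h \<Rightarrow> 'x::real_normed_vector) \<Rightarrow> ennreal" where
  "lip_norm d \<phi> = (SUP (u, v)\<in>{(u, v). u \<noteq> v}. ennreal (norm (\<phi> u - \<phi> v) / d u v))"

(* The sigma-algebra on the sample space generated by U 0, ..., U k. *)
definition past ::
    "'w measure \<Rightarrow> (nat \<Rightarrow> 'w \<Rightarrow> 'h::topological_space) \<Rightarrow> nat \<Rightarrow> 'w measure" where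
  "past M U k =
     vimage_algebra (space M) (\<lambda>\<omega>. \<lambda>i\<in>{..k}. U i \<omega>) (Pi\<^sub>M {..k} (\<lambda>_. borel))"

definition markov_chain ::
    "'w measure \<Rightarrow> (nat \<Rightarrow> 'w \<Rightarrow> 'h::topological_space) \<Rightarrow> ('h \<Rightarrow> 'h measure) \<Rightarrow> 'h \<Rightarrow> bool" where
  "markov_chain M U P u0 \<longleftrightarrow>
     prob_space M \<and> (\<forall>k. U k \<in> measurable M borel) \<and> (AE \<omega> in M. U 0 \<omega> = u0) \<and>
     (\<forall>k. \<forall>A\<in>sets borel. AE \<omega> in M.
        real_cond_exp M (past M U k) (\<lambda>\<omega>'. indicator A (U (Suc k) \<omega>')) \<omega> = measure (P (U k \<omega>)) A)"

end

theory Submission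
  imports Defs
begin

text \<open>Write \<open>dt\<close> for the weighted distance \<open>dtilde d V \<theta>\<close>. The error of an ergodic average of \<open>\<phi>\<close> is
controlled by the Poisson equation \<open>F - P0 F = \<phi> - \<nu>0(\<phi>)\<close>. Along a chain with kernel \<open>P\<close> it gives
\[ \sum_{k<n} (\phi(U_k) - \nu_0(\phi)) = F(U_0) - F(U_n)
   + \sum_{k<n} (F(U_{k+1}) - PF(U_k)) + \sum_{k<n} (P - P_0)F(U_k). \]
If \<open>F\<close> is Lipschitz for \<open>dt\<close> with constant \<open>\<Lambda>\<close>, the boundary term is of order \<open>\<Lambda>\<close>, because the Lyapunov
bound keeps \<open>V\<close> of the chain bounded in expectation; the second sum consists of orthogonal martingale
increments, so that its expectation vanishes and its norm is of order \<open>\<Lambda> * sqrt n\<close>; and each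
term of the third sum is in expectation of the order of \<open>\<Lambda>\<close> times the perturbation size. Division by \<open>n\<close> gives both
estimates (\<open>ergodic_average_le\<close>).

The function \<open>F\<close> is the truncated Neumann series, the sum of \<open>P0^k \<phi>\<close> over \<open>k < m * n0\<close>
(\<open>corrector\<close>). By the easy half of Kantorovich duality (\<open>norm_integral_diff_le_wass\<close>), contraction of a
kernel in the transport distance of \<open>dt\<close> contracts Lipschitz constants. Each block of \<open>n0\<close> steps
contributes a factor \<open>\<gamma>\<close>. Within a block, one step costs at most the factor \<open>sqrt (1 + \<theta> * K0)\<close>:
this follows from the contraction of \<open>d\<close> and the Lyapunov function
(\<open>wass_contraction_imp_dt_lipschitz\<close>). Hence the Lipschitz constant of \<open>F\<close> is at most that of \<open>\<phi>\<close>
times \<open>S / (1 - \<gamma>)\<close>, uniformly in \<open>m\<close>, where \<open>S\<close> is a finite geometric sum. The truncation leaves the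
remainder \<open>P0^(m * n0) \<phi> - \<nu>0(\<phi>)\<close>, which decays like \<open>\<gamma>^m\<close>; letting \<open>m\<close> tend to infinity removes it.
The finite sum makes every exchange of sum and integral elementary.

A subtle point is the dependence on the starting point. The average of \<open>sqrt V\<close> along the chain has
a transient part of order \<open>sqrt (V u0) / n\<close>, which enters multiplied by the perturbation size, while the
constants in front of \<open>\<psi>\<close> in the bias estimate must not depend on \<open>u0\<close>. Since \<open>d \<le> 1\<close>, the two
Lyapunov bounds alone already bound the distance of \<open>P0 u\<close> and \<open>P u\<close> by \<open>c * (1 + sqrt (V u))\<close>
(\<open>wass_dt_le_of_lyapunov\<close>). So the perturbation size may be taken as \<open>min \<psi> c\<close>: it is bounded by
\<open>\<psi>\<close> in the stationary part and by \<open>c\<close> in the transient part, which then belongs to the pure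
\<open>1 / n\<close> term.\<close>

section \<open>Bochner integrals against mixtures of measures\<close>

lemma real_integral_bind:
  fixes f :: "'b \<Rightarrow> real"
  assumes P: "P \<in> M \<rightarrow>\<^sub>M subprob_algebra N" and f[measurable]: "f \<in> borel_measurable N"
    and M: "space M \<noteq> {}"
    and inner: "\<And>x. x \<in> space M \<Longrightarrow> integrable (P x) f"
    and int: "integrable (bind M P) f"
  shows "(\<integral>y. f y \<partial>bind M P) = (\<integral>x. \<integral>y. f y \<partial>P x \<partial>M)"
    and "integrable M (\<lambda>x. \<integral>y. f y \<partial>P x)"
proof -
  note P[measurable]
  define Fp where "Fp x = (\<integral>\<^sup>+y. ennreal (f y) \<partial>P x)" for x
  define Fm where "Fm x = (\<integral>\<^sup>+y. ennreal (- f y) \<partial>P x)" for x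
  have [measurable]: "Fp \<in> borel_measurable M" "Fm \<in> borel_measurable M"
    unfolding Fp_def Fm_def
    by (rule measurable_compose[OF P nn_integral_measurable_subprob_algebra], measurable)+
  have bp: "(\<integral>\<^sup>+x. Fp x \<partial>M) = (\<integral>\<^sup>+y. ennreal (f y) \<partial>bind M P)"
    and bm: "(\<integral>\<^sup>+x. Fm x \<partial>M) = (\<integral>\<^sup>+y. ennreal (- f y) \<partial>bind M P)"
    unfolding Fp_def Fm_def by (rule nn_integral_bind[OF _ P, symmetric], measurable)+
  have fp: "(\<integral>\<^sup>+x. Fp x \<partial>M) \<noteq> \<infinity>" and fm: "(\<integral>\<^sup>+x. Fm x \<partial>M) \<noteq> \<infinity>"
    using int unfolding bp bm real_integrable_def by auto
  have eq: "(\<integral>y. f y \<partial>P x) = enn2real (Fp x) - enn2real (Fm x)"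
    and fin: "ennreal (enn2real (Fp x)) = Fp x" "ennreal (enn2real (Fm x)) = Fm x"
    if "x \<in> space M" for x
    using inner[OF that] real_lebesgue_integral_def[OF inner[OF that]]
    unfolding Fp_def Fm_def real_integrable_def by (auto simp: less_top)
  have ip: "integrable M (\<lambda>x. enn2real (Fp x))" "(\<integral>x. enn2real (Fp x) \<partial>M) = enn2real (\<integral>\<^sup>+x. Fp x \<partial>M)"
    using fp fin(1)
    by (auto intro!: integrableI_nonneg simp: integral_eq_nn_integral less_top cong: nn_integral_cong)
  have im: "integrable M (\<lambda>x. enn2real (Fm x))" "(\<integral>x. enn2real (Fm x) \<partial>M) = enn2real (\<integral>\<^sup>+x. Fm x \<partial>M)"
    using fm fin(2)
    by (auto intro!: integrableI_nonneg simp: integral_eq_nn_integral less_top cong: nn_integral_cong)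
  have "(\<integral>x. \<integral>y. f y \<partial>P x \<partial>M) = (\<integral>x. enn2real (Fp x) - enn2real (Fm x) \<partial>M)"
    by (rule Bochner_Integration.integral_cong) (simp_all add: eq)
  also have "\<dots> = enn2real (\<integral>\<^sup>+x. Fp x \<partial>M) - enn2real (\<integral>\<^sup>+x. Fm x \<partial>M)"
    by (simp add: ip im)
  also have "\<dots> = (\<integral>y. f y \<partial>bind M P)"
    by (simp add: bp bm real_lebesgue_integral_def[OF int])
  finally show "(\<integral>y. f y \<partial>bind M P) = (\<integral>x. \<integral>y. f y \<partial>P x \<partial>M)" ..
  have "integrable M (\<lambda>x. enn2real (Fp x) - enn2real (Fm x))"
    using ip im by simp
  then show "integrable M (\<lambda>x. \<integral>y. f y \<partial>P x)"
    by (rule Bochner_Integration.integrable_cong[THEN iffD1, rotated -1]) (simp_all add: eq)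
qed

text \<open>Testing against all vectors \<open>w\<close> reduces the vector-valued Fubini rule to the real one, which in turn
follows from \<open>nn_integral_bind\<close> for the positive and negative parts. In contrast to
\<open>integral_bind\<close>, the integrand may be unbounded.\<close>
lemma integral_bind_inner:
  fixes f :: "'b \<Rightarrow> 'x::{real_inner, banach, second_countable_topology}"
  assumes P: "P \<in> M \<rightarrow>\<^sub>M subprob_algebra N" and f[measurable]: "f \<in> borel_measurable N"
    and M: "space M \<noteq> {}"
    and inner: "\<And>x. x \<in> space M \<Longrightarrow> integrable (P x) f"
    and int: "integrable (bind M P) f"
  shows "(\<integral>y. f y \<partial>bind M P) = (\<integral>x. \<integral>y. f y \<partial>P x \<partial>M)"
    and "integrable M (\<lambda>x. \<integral>y. f y \<partial>P x)"
proof -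
  have meas[measurable]: "(\<lambda>x. \<integral>y. f y \<partial>P x) \<in> borel_measurable M"
    by (rule measurable_compose[OF P integral_measurable_subprob_algebra]) measurable
  have "integrable M (\<lambda>x. \<integral>y. norm (f y) \<partial>P x)"
    by (rule real_integral_bind(2)[OF P _ M]) (use inner int in auto)
  then show I: "integrable M (\<lambda>x. \<integral>y. f y \<partial>P x)"
    by (rule Bochner_Integration.integrable_bound)
       (auto intro!: AE_I2 order_trans[OF integral_norm_bound])
  have "w \<bullet> (\<integral>y. f y \<partial>bind M P) = w \<bullet> (\<integral>x. \<integral>y. f y \<partial>P x \<partial>M)" for w
  proof -
    have "w \<bullet> (\<integral>y. f y \<partial>bind M P) = (\<integral>y. w \<bullet> f y \<partial>bind M P)"
      by (simp add: integral_inner_right[OF int])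
    also have "\<dots> = (\<integral>x. \<integral>y. w \<bullet> f y \<partial>P x \<partial>M)"
      by (rule real_integral_bind(1)[OF P _ M]) (use inner int in auto)
    also have "\<dots> = (\<integral>x. w \<bullet> (\<integral>y. f y \<partial>P x) \<partial>M)"
      by (rule Bochner_Integration.integral_cong) (use inner in auto)
    also have "\<dots> = w \<bullet> (\<integral>x. \<integral>y. f y \<partial>P x \<partial>M)"
      by (simp add: integral_inner_right[OF I])
    finally show ?thesis .
  qed
  then show "(\<integral>y. f y \<partial>bind M P) = (\<integral>x. \<integral>y. f y \<partial>P x \<partial>M)"
    by (metis vector_eq_rdot inner_commute)
qed

section \<open>The joint law of the past and the next state of a Markov chain\<close>

lemma subalgebra_past:
  assumes "\<And>i. U i \<in> measurable M borel"
  shows "subalgebra M (past M U k)"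
proof -
  have U: "(\<lambda>\<omega>. \<lambda>i\<in>{..k}. U i \<omega>) \<in> M \<rightarrow>\<^sub>M Pi\<^sub>M {..k} (\<lambda>_. borel)"
    using assms by (intro measurable_restrict) auto
  have "sets (past M U k) \<subseteq> sets M"
    unfolding past_def using measurable_sets[OF U] measurable_space[OF U]
    by (subst sets_vimage_algebra2) blast+
  then show ?thesis
    unfolding subalgebra_def by (simp add: past_def)
qed

lemma measurable_past:
  assumes "i \<le> k"
  shows "U i \<in> measurable (past M U k) borel"
proof -
  have "(\<lambda>\<omega>. \<lambda>i\<in>{..k}. U i \<omega>) \<in> past M U k \<rightarrow>\<^sub>M Pi\<^sub>M {..k} (\<lambda>_. borel)"
    unfolding past_def by (rule measurable_vimage_algebra1) (auto simp: space_PiM)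
  from measurable_compose[OF this measurable_component_singleton[of i]]
  show ?thesis using assms by simp
qed

text \<open>The defining property of a chain concerns events of the next state alone, one at a time. Here it is upgraded to
functions of the past and the next state jointly: the law of \<open>(\<omega>, U (Suc k) \<omega>)\<close> and the mixture of
the kernels \<open>P (U k \<omega>)\<close> agree on rectangles, by the averaging property of the conditional expectation,
hence everywhere.\<close>
lemma markov_chain_nn_integral:
  assumes chain: "markov_chain M U P u0" and P: "markov_kernel P"
    and f[measurable]: "(\<lambda>(\<omega>, y). f \<omega> y) \<in> borel_measurable (past M U k \<Otimes>\<^sub>M borel)"
  shows "(\<integral>\<^sup>+\<omega>. f \<omega> (U (Suc k) \<omega>) \<partial>M) = (\<integral>\<^sup>+\<omega>. \<integral>\<^sup>+y. f \<omega> y \<partial>P (U k \<omega>) \<partial>M)"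
proof -
  define F where "F = past M U k"
  have U[measurable]: "\<And>i. U i \<in> measurable M borel"
    and cond: "\<And>A. A \<in> sets borel \<Longrightarrow> AE \<omega> in M.
        real_cond_exp M F (\<lambda>\<omega>'. indicator A (U (Suc k) \<omega>')) \<omega> = measure (P (U k \<omega>)) A"
    using chain unfolding markov_chain_def F_def by auto
  interpret prob_space M using chain unfolding markov_chain_def by simp
  have sub: "subalgebra M F" unfolding F_def by (rule subalgebra_past[OF U])
  interpret finite_measure_subalgebra M F by unfold_locales (rule sub)
  have spF[simp]: "space F = space M" using sub unfolding subalgebra_def by simp
  have id[measurable]: "(\<lambda>\<omega>. \<omega>) \<in> M \<rightarrow>\<^sub>M F"
    using measurable_from_subalg[OF sub measurable_ident] by (simp add: id_def)
  have P'[measurable]: "P \<in> borel \<rightarrow>\<^sub>M prob_algebra borel" using P unfolding markov_kernel_def .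
  have PU: "(\<lambda>\<omega>. P (U k \<omega>)) \<in> M \<rightarrow>\<^sub>M prob_algebra borel" by measurable
  have Psp: "sets (P u) = sets borel" "prob_space (P u)" for u
    using measurable_space[OF P', of u] by (auto simp: space_prob_algebra)
  define Q where "Q \<omega> = distr (P (U k \<omega>)) (F \<Otimes>\<^sub>M borel) (Pair \<omega>)" for \<omega>
  have Q: "Q \<in> M \<rightarrow>\<^sub>M subprob_algebra (F \<Otimes>\<^sub>M borel)"
    unfolding Q_def by (rule measurable_distr2[OF _ measurable_prob_algebraD[OF PU]]) measurable
  have mS[measurable]: "(\<lambda>\<omega>. (\<omega>, U (Suc k) \<omega>)) \<in> M \<rightarrow>\<^sub>M F \<Otimes>\<^sub>M borel" by measurable
  have mP: "Pair \<omega> \<in> P (U k \<omega>) \<rightarrow>\<^sub>M F \<Otimes>\<^sub>M borel" if "\<omega> \<in> space M" for \<omega>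
    using that by (auto intro!: measurable_Pair1' simp: measurable_cong_sets[OF Psp(1) refl])
  have ne: "space M \<noteq> {}" by (rule not_empty)
  have law: "distr M (F \<Otimes>\<^sub>M borel) (\<lambda>\<omega>. (\<omega>, U (Suc k) \<omega>)) = bind M Q"
  proof (rule measure_eqI_generator_eq[where \<Omega> = "space F \<times> space borel"
        and E = "{a \<times> b |a b. a \<in> sets F \<and> b \<in> sets borel}" and A = "\<lambda>_. space F \<times> space borel"])
    fix X assume "X \<in> {a \<times> b |a b. a \<in> sets F \<and> b \<in> sets (borel::'b measure)}"
    then obtain a b where X: "X = a \<times> b" and a: "a \<in> sets F" and b[measurable]: "b \<in> sets borel"
      by auto
    have aM[measurable]: "a \<in> sets M" using a sub unfolding subalgebra_def by auto
    have i1: "integrable M (\<lambda>\<omega>. indicator b (U (Suc k) \<omega>) :: real)"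
      by (rule integrable_const_bound[where B=1]) (auto simp: indicator_def)
    have mb[measurable]: "(\<lambda>\<omega>. measure (P (U k \<omega>)) b) \<in> borel_measurable M"
      by measurable
    have "emeasure (distr M (F \<Otimes>\<^sub>M borel) (\<lambda>\<omega>. (\<omega>, U (Suc k) \<omega>))) X
        = emeasure M ((\<lambda>\<omega>. (\<omega>, U (Suc k) \<omega>)) -` X \<inter> space M)"
      using a b unfolding X by (intro emeasure_distr mS) auto
    also have "(\<lambda>\<omega>. (\<omega>, U (Suc k) \<omega>)) -` X \<inter> space M = {\<omega>\<in>space M. \<omega> \<in> a \<and> U (Suc k) \<omega> \<in> b}"
      by (auto simp: X)
    also have "emeasure M \<dots> = ennreal (\<integral>\<omega>. indicat_real a \<omega> * indicator b (U (Suc k) \<omega>) \<partial>M)"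
    proof -
      have "(\<integral>\<omega>. indicat_real a \<omega> * indicator b (U (Suc k) \<omega>) \<partial>M)
          = (\<integral>\<omega>. indicator {\<omega>\<in>space M. \<omega> \<in> a \<and> U (Suc k) \<omega> \<in> b} \<omega> \<partial>M)"
        by (rule Bochner_Integration.integral_cong) (auto simp: indicator_def)
      then show ?thesis by (simp add: emeasure_eq_measure)
    qed
    also have "(\<integral>\<omega>. indicat_real a \<omega> * indicator b (U (Suc k) \<omega>) \<partial>M)
        = (\<integral>\<omega>. indicator a \<omega> * measure (P (U k \<omega>)) b \<partial>M)"
    proof -
      have "(\<integral>\<omega>. indicat_real a \<omega> * indicator b (U (Suc k) \<omega>) \<partial>M)
          = (\<integral>\<omega>. indicator a \<omega> * real_cond_exp M F (\<lambda>\<omega>'. indicator b (U (Suc k) \<omega>')) \<omega> \<partial>M)"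
        using real_cond_exp_intA[OF i1 a] by (simp add: set_lebesgue_integral_def)
      also have "\<dots> = (\<integral>\<omega>. indicator a \<omega> * measure (P (U k \<omega>)) b \<partial>M)"
        using cond[OF b] by (intro integral_cong_AE) (auto simp: )
      finally show ?thesis .
    qed
    also have "ennreal \<dots> = (\<integral>\<^sup>+\<omega>. ennreal (indicator a \<omega> * measure (P (U k \<omega>)) b) \<partial>M)"
      by (rule nn_integral_eq_integral[symmetric], rule integrable_const_bound[where B=1])
         (auto simp: indicator_def intro!: prob_space.prob_le_1 Psp)
    also have "\<dots> = (\<integral>\<^sup>+\<omega>. emeasure (Q \<omega>) X \<partial>M)"
    proof (rule nn_integral_cong)
      fix \<omega> assume w: "\<omega> \<in> space M"
      interpret Pu: prob_space "P (U k \<omega>)" by (rule Psp)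
      have "emeasure (Q \<omega>) X = emeasure (P (U k \<omega>)) (Pair \<omega> -` X \<inter> space (P (U k \<omega>)))"
        unfolding Q_def using a b X by (intro emeasure_distr mP w) auto
      also have "Pair \<omega> -` X \<inter> space (P (U k \<omega>)) = (if \<omega> \<in> a then b else {})"
        using sets_eq_imp_space_eq[OF Psp(1)] by (auto simp: X)
      finally show "ennreal (indicator a \<omega> * measure (P (U k \<omega>)) b) = emeasure (Q \<omega>) X"
        by (simp add: Pu.emeasure_eq_measure)
    qed
    also have "\<dots> = emeasure (bind M Q) X"
      using a b unfolding X by (intro emeasure_bind[OF ne Q, symmetric]) auto
    finally show "emeasure (distr M (F \<Otimes>\<^sub>M borel) (\<lambda>\<omega>. (\<omega>, U (Suc k) \<omega>))) X = emeasure (bind M Q) X" .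
  next
    fix i :: nat
    show "emeasure (distr M (F \<Otimes>\<^sub>M borel) (\<lambda>\<omega>. (\<omega>, U (Suc k) \<omega>))) (space F \<times> space borel) \<noteq> \<infinity>"
      using prob_space.finite_measure[OF prob_space_distr[OF mS]] finite_measure.emeasure_finite by auto
  next
    show "sets (bind M Q) = sigma_sets (space F \<times> space borel) {a \<times> b |a b. a \<in> sets F \<and> b \<in> sets borel}"
      using sets_bind[OF sets_kernel[OF Q] ne] by (simp add: sets_pair_measure)
  next
    show "{a \<times> b |a b. a \<in> sets F \<and> b \<in> sets borel} \<subseteq> Pow (space F \<times> space (borel :: 'b measure))"
      by (rule pair_measure_closed)
  next
    show "range (\<lambda>_::nat. space F \<times> space borel) \<subseteq> {a \<times> b |a b. a \<in> sets F \<and> b \<in> sets (borel :: 'b measure)}"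
      using sets.top[of F] sets.top[of "borel :: 'b measure"] by blast
  qed (auto simp: Int_stable_pair_measure_generator sets_pair_measure)
  note f' = f[folded F_def]
  have "(\<integral>\<^sup>+\<omega>. f \<omega> (U (Suc k) \<omega>) \<partial>M) = (\<integral>\<^sup>+z. (case z of (\<omega>, y) \<Rightarrow> f \<omega> y) \<partial>bind M Q)"
    unfolding law[symmetric] by (subst nn_integral_distr[OF mS]) (use f' in auto)
  also have "\<dots> = (\<integral>\<^sup>+\<omega>. \<integral>\<^sup>+z. (case z of (\<omega>, y) \<Rightarrow> f \<omega> y) \<partial>Q \<omega> \<partial>M)"
    by (rule nn_integral_bind[OF f' Q])
  also have "\<dots> = (\<integral>\<^sup>+\<omega>. \<integral>\<^sup>+y. f \<omega> y \<partial>P (U k \<omega>) \<partial>M)"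
    unfolding Q_def by (intro nn_integral_cong) (subst nn_integral_distr[OF mP], use f' in auto)
  finally show ?thesis .
qed

text \<open>The martingale property in weak form. Pairing with an arbitrary past-measurable vector \<open>Z\<close> makes the
statement real-valued, so conditional expectations of vector-valued functions are avoided. For a
fixed past, the inner integral over the next state vanishes, that is, the positive and
negative parts of the integrand have the same mass.\<close>
lemma markov_chain_increment_orthogonal:
  fixes f :: "'h::topological_space \<Rightarrow> 'x::{real_inner, banach, second_countable_topology}"
  assumes chain: "markov_chain M U P u0" and P: "markov_kernel P"
    and f[measurable]: "f \<in> borel_measurable borel" and fint: "\<And>u. integrable (P u) f"
    and Z[measurable]: "Z \<in> borel_measurable (past M U k)"
    and int: "integrable M (\<lambda>\<omega>. Z \<omega> \<bullet> (f (U (Suc k) \<omega>) - (\<integral>y. f y \<partial>P (U k \<omega>))))"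
  shows "(\<integral>\<omega>. Z \<omega> \<bullet> (f (U (Suc k) \<omega>) - (\<integral>y. f y \<partial>P (U k \<omega>))) \<partial>M) = 0"
proof -
  define Pf where "Pf u = (\<integral>y. f y \<partial>P u)" for u
  have P'[measurable]: "P \<in> borel \<rightarrow>\<^sub>M prob_algebra borel" using P unfolding markov_kernel_def .
  have [measurable]: "Pf \<in> borel_measurable borel" unfolding Pf_def
    by (rule measurable_compose[OF measurable_prob_algebraD[OF P'] integral_measurable_subprob_algebra]) measurable
  have [measurable]: "U k \<in> measurable (past M U k) borel" by (rule measurable_past) simp
  define g where "g \<omega> y = Z \<omega> \<bullet> (f y - Pf (U k \<omega>))" for \<omega> y
  have gm[measurable]: "(\<lambda>(\<omega>, y). g \<omega> y) \<in> borel_measurable (past M U k \<Otimes>\<^sub>M borel)"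
    unfolding g_def by measurable
  have Ppr: "prob_space (P u)" for u
    using measurable_space[OF P', of u] by (auto simp: space_prob_algebra)
  have inner: "(\<integral>\<^sup>+y. ennreal (g \<omega> y) \<partial>P (U k \<omega>)) = (\<integral>\<^sup>+y. ennreal (- g \<omega> y) \<partial>P (U k \<omega>))" for \<omega>
  proof -
    interpret Pu: prob_space "P (U k \<omega>)" by (rule Ppr)
    have i: "integrable (P (U k \<omega>)) (g \<omega>)"
      unfolding g_def by (intro integrable_inner_right Bochner_Integration.integrable_diff fint) auto
    have "(\<integral>y. g \<omega> y \<partial>P (U k \<omega>)) = 0"
      unfolding g_def using fint Pu.prob_space
      by (simp add: Pf_def)
    with real_lebesgue_integral_def[OF i]
    have "enn2real (\<integral>\<^sup>+y. ennreal (g \<omega> y) \<partial>P (U k \<omega>)) = enn2real (\<integral>\<^sup>+y. ennreal (- g \<omega> y) \<partial>P (U k \<omega>))"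
      by simp
    with i show ?thesis unfolding real_integrable_def
      by (metis ennreal_enn2real less_top infinity_ennreal_def)
  qed
  have "(\<integral>\<^sup>+\<omega>. ennreal (g \<omega> (U (Suc k) \<omega>)) \<partial>M) = (\<integral>\<^sup>+\<omega>. \<integral>\<^sup>+y. ennreal (g \<omega> y) \<partial>P (U k \<omega>) \<partial>M)"
    by (rule markov_chain_nn_integral[OF chain P]) measurable
  also have "\<dots> = (\<integral>\<^sup>+\<omega>. \<integral>\<^sup>+y. ennreal (- g \<omega> y) \<partial>P (U k \<omega>) \<partial>M)"
    by (simp add: inner)
  also have "\<dots> = (\<integral>\<^sup>+\<omega>. ennreal (- g \<omega> (U (Suc k) \<omega>)) \<partial>M)"
    by (rule markov_chain_nn_integral[OF chain P, symmetric]) measurable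
  finally show ?thesis
    using real_lebesgue_integral_def[OF int] unfolding g_def Pf_def by simp
qed

section \<open>Couplings and kernels\<close>

lemma lower_semicontinuous_imp_borel_measurable:
  assumes "lower_semicontinuous f"
  shows "f \<in> borel_measurable borel"
proof (rule borel_measurableI_greater)
  fix y
  have "open {x. y < f x}"
  proof (subst open_subopen, intro ballI)
    fix x assume "x \<in> {x. y < f x}"
    then obtain S where "open S" "x \<in> S" "\<forall>z\<in>S. y < f z"
      using assms unfolding lower_semicontinuous_def eventually_nhds by (metis mem_Collect_eq)
    then show "\<exists>T. open T \<and> x \<in> T \<and> T \<subseteq> {x. y < f x}"
      by (intro exI[of _ S]) auto
  qed
  then show "{x \<in> space borel. y < f x} \<in> sets borel" by simp
qed

lemma ennreal_power2_le_imp_le_sqrt: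
  assumes "x\<^sup>2 \<le> ennreal b" "0 \<le> b"
  shows "x \<le> ennreal (sqrt b)"
proof (cases x)
  case (real r)
  have "r\<^sup>2 \<le> b"
    using assms real by (simp add: ennreal_power)
  then show ?thesis using real by (simp add: real_le_rsqrt ennreal_leI)
next
  case top
  then show ?thesis using assms by (simp add: top_unique)
qed

lemma couplings_product:
  assumes "prob_space \<mu>1" "prob_space \<mu>2" "sets \<mu>1 = sets borel" "sets \<mu>2 = sets borel"
  shows "\<mu>1 \<Otimes>\<^sub>M \<mu>2 \<in> couplings \<mu>1 \<mu>2"
proof -
  interpret A: prob_space \<mu>1 by fact
  interpret B: prob_space \<mu>2 by fact
  interpret pair_prob_space \<mu>1 \<mu>2 by unfold_locales
  have "distr (\<mu>1 \<Otimes>\<^sub>M \<mu>2) borel fst = \<mu>1"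
    using B.distr_pair_fst[of \<mu>1] distr_cong[OF refl assms(3), of "\<mu>1 \<Otimes>\<^sub>M \<mu>2" fst fst] by simp
  moreover have "distr (\<mu>1 \<Otimes>\<^sub>M \<mu>2) borel snd = \<mu>2"
  proof (rule measure_eqI)
    fix X assume "X \<in> sets (distr (\<mu>1 \<Otimes>\<^sub>M \<mu>2) borel snd)"
    then have X: "X \<in> sets \<mu>2" "X \<in> sets borel" by (simp_all add: assms)
    have m: "snd \<in> \<mu>1 \<Otimes>\<^sub>M \<mu>2 \<rightarrow>\<^sub>M borel"
      using measurable_snd measurable_cong_sets[OF refl assms(4)] by blast
    have "emeasure (distr (\<mu>1 \<Otimes>\<^sub>M \<mu>2) borel snd) X = emeasure (\<mu>1 \<Otimes>\<^sub>M \<mu>2) (space \<mu>1 \<times> X)"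
      using sets.sets_into_space[OF X(1)] by (subst emeasure_distr[OF m X(2)]) (auto intro!: arg_cong2[where f=emeasure] simp: space_pair_measure)
    also have "\<dots> = emeasure \<mu>2 X"
      using X by (simp add: B.emeasure_pair_measure_Times A.emeasure_space_1)
    finally show "emeasure (distr (\<mu>1 \<Otimes>\<^sub>M \<mu>2) borel snd) X = emeasure \<mu>2 X" .
  qed (simp add: assms)
  ultimately show ?thesis
    unfolding couplings_def using P.prob_space_axioms sets_pair_measure_cong[OF assms(3,4)] by simp
qed

lemma couplings_marginals:
  assumes "\<pi> \<in> couplings \<mu>1 \<mu>2"
  shows "prob_space \<pi>" and "fst \<in> \<pi> \<rightarrow>\<^sub>M borel" and "snd \<in> \<pi> \<rightarrow>\<^sub>M borel"
    and "distr \<pi> borel fst = \<mu>1" and "distr \<pi> borel snd = \<mu>2"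
    and "g \<in> borel_measurable borel \<Longrightarrow> (\<integral>\<^sup>+z. g (fst z) \<partial>\<pi>) = (\<integral>\<^sup>+u. g u \<partial>\<mu>1)"
    and "g \<in> borel_measurable borel \<Longrightarrow> (\<integral>\<^sup>+z. g (snd z) \<partial>\<pi>) = (\<integral>\<^sup>+u. g u \<partial>\<mu>2)"
proof -
  have s: "sets \<pi> = sets (borel \<Otimes>\<^sub>M borel)"
    and d1: "distr \<pi> borel fst = \<mu>1" and d2: "distr \<pi> borel snd = \<mu>2" and "prob_space \<pi>"
    using assms unfolding couplings_def by auto
  moreover have m: "fst \<in> \<pi> \<rightarrow>\<^sub>M borel" "snd \<in> \<pi> \<rightarrow>\<^sub>M borel"
    by (simp_all add: measurable_cong_sets[OF s refl])
  ultimately show "prob_space \<pi>" "fst \<in> \<pi> \<rightarrow>\<^sub>M borel" "snd \<in> \<pi> \<rightarrow>\<^sub>M borel"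
    "distr \<pi> borel fst = \<mu>1" "distr \<pi> borel snd = \<mu>2"
    by auto
  assume g: "g \<in> borel_measurable borel"
  show "(\<integral>\<^sup>+z. g (fst z) \<partial>\<pi>) = (\<integral>\<^sup>+u. g u \<partial>\<mu>1)" "(\<integral>\<^sup>+z. g (snd z) \<partial>\<pi>) = (\<integral>\<^sup>+u. g u \<partial>\<mu>2)"
    unfolding d1[symmetric] d2[symmetric] using g
    by (simp_all add: nn_integral_distr[OF m(1)] nn_integral_distr[OF m(2)])
qed

definition kernel_op :: "('h \<Rightarrow> 'h measure) \<Rightarrow> ('h \<Rightarrow> 'x::{banach, second_countable_topology}) \<Rightarrow> 'h \<Rightarrow> 'x" where
  "kernel_op P f u = (\<integral>y. f y \<partial>P u)"

lemma kernel_op_measurable: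
  assumes "markov_kernel P" "f \<in> borel_measurable borel"
  shows "kernel_op P f \<in> borel_measurable borel"
  unfolding kernel_op_def
  using assms(1)[unfolded markov_kernel_def, THEN measurable_prob_algebraD]
  by (rule measurable_compose[OF _ integral_measurable_subprob_algebra[OF assms(2)]])

lemma markov_kernelD:
  assumes "markov_kernel P"
  shows "prob_space (P u)" "sets (P u) = sets borel" "P \<in> borel \<rightarrow>\<^sub>M subprob_algebra borel"
proof -
  have P: "P \<in> borel \<rightarrow>\<^sub>M prob_algebra borel" using assms unfolding markov_kernel_def .
  show "prob_space (P u)" "sets (P u) = sets borel"
    using measurable_space[OF P, of u] by (simp_all add: space_prob_algebra)
  show "P \<in> borel \<rightarrow>\<^sub>M subprob_algebra borel" using P by (rule measurable_prob_algebraD)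
qed

lemma lyapunov_boundD:
  assumes "lyapunov_bound P V \<kappa> K"
  shows "0 < \<kappa>" "\<kappa> < 1" "0 < K" "(\<integral>\<^sup>+ v. ennreal (V v) \<partial>P u) \<le> ennreal (\<kappa> * V u + K)"
  using assms unfolding lyapunov_bound_def by blast+

section \<open>The weighted distance\<close>

locale weighted_distance =
  fixes d :: "'h::{second_countable_topology, zero} \<Rightarrow> 'h \<Rightarrow> real" and V :: "'h \<Rightarrow> real" and \<theta> :: real
  assumes dl: "distance_like d" and d_le_1: "d u v \<le> 1"
    and V_cont: "continuous_on UNIV V" and V_nonneg: "0 \<le> V u" and \<theta>: "0 < \<theta>"
begin

abbreviation dt :: "'h \<Rightarrow> 'h \<Rightarrow> real" where "dt \<equiv> dtilde d V \<theta>"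

definition lip_bound :: "real \<Rightarrow> ('h \<Rightarrow> 'x::real_normed_vector) \<Rightarrow> bool" where
  "lip_bound L f \<longleftrightarrow> (\<forall>u v. norm (f u - f v) \<le> L * dt u v)"

text \<open>Every \<open>dt\<close>-Lipschitz function is integrable against such a measure. The reference point \<open>0\<close> is the one
in \<open>P1\<close>, so that members of \<open>P1\<close> qualify; a finite \<open>V\<close>-moment is sufficient as well (\<open>first_momentI\<close>).\<close>
definition first_moment :: "'h measure \<Rightarrow> bool" where
  "first_moment \<mu> \<longleftrightarrow> prob_space \<mu> \<and> sets \<mu> = sets borel \<and> (\<integral>\<^sup>+u. ennreal (dt u 0) \<partial>\<mu>) < \<infinity>"

lemma d_nonneg: "0 \<le> d u v" and d_eq_0: "d u v = 0 \<longleftrightarrow> u = v"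
  using dl unfolding distance_like_def by auto

lemma V_measurable[measurable]: "V \<in> borel_measurable borel"
  using V_cont by (rule borel_measurable_continuous_onI)

lemma d_measurable[measurable]: "(\<lambda>(u, v). d u v) \<in> borel_measurable (borel \<Otimes>\<^sub>M borel)"
  unfolding borel_prod
  using dl unfolding distance_like_def by (intro lower_semicontinuous_imp_borel_measurable) auto

lemma weight_pos: "0 < 2 + \<theta> * V u + \<theta> * V v"
  using V_nonneg[of u] V_nonneg[of v] \<theta> by (simp add: add_pos_nonneg)

lemma dt_nonneg: "0 \<le> dt u v"
  unfolding dtilde_def using d_nonneg[of u v] weight_pos[of u v] by simp

lemma dt_self[simp]: "dt u u = 0"
  unfolding dtilde_def using d_eq_0[of u u] by simp

lemma dt_pos: "u \<noteq> v \<Longrightarrow> 0 < dt u v"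
  unfolding dtilde_def using d_nonneg[of u v] d_eq_0[of u v] weight_pos[of u v] by (simp add: less_le)

lemma dt_measurable[measurable]: "(\<lambda>(u, v). dt u v) \<in> borel_measurable (borel \<Otimes>\<^sub>M borel)"
  unfolding dtilde_def using d_measurable by measurable

text \<open>The square root in \<open>dtilde\<close> is what makes Cauchy-Schwarz applicable: a bound on the expectation of \<open>d\<close> and
bounds on the \<open>V\<close>-moments combine multiplicatively.\<close>
lemma nn_integral_dt_le:
  assumes N: "prob_space N" and [measurable]: "X \<in> N \<rightarrow>\<^sub>M borel" "Y \<in> N \<rightarrow>\<^sub>M borel"
    and a: "(\<integral>\<^sup>+\<omega>. ennreal (d (X \<omega>) (Y \<omega>)) \<partial>N) \<le> ennreal a" "0 \<le> a"
    and b1: "(\<integral>\<^sup>+\<omega>. ennreal (V (X \<omega>)) \<partial>N) \<le> ennreal b1" "0 \<le> b1"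
    and b2: "(\<integral>\<^sup>+\<omega>. ennreal (V (Y \<omega>)) \<partial>N) \<le> ennreal b2" "0 \<le> b2"
  shows "(\<integral>\<^sup>+\<omega>. ennreal (dt (X \<omega>) (Y \<omega>)) \<partial>N) \<le> ennreal (sqrt (a * (2 + \<theta> * b1 + \<theta> * b2)))"
proof -
  interpret prob_space N by fact
  let ?w = "\<lambda>\<omega>. 2 + \<theta> * V (X \<omega>) + \<theta> * V (Y \<omega>)"
  have [measurable]: "(\<lambda>\<omega>. d (X \<omega>) (Y \<omega>)) \<in> borel_measurable N"
    using measurable_compose[OF measurable_Pair[of X N borel Y borel] d_measurable] by simp
  have "(\<integral>\<^sup>+\<omega>. ennreal (?w \<omega>) \<partial>N)
      = (\<integral>\<^sup>+\<omega>. 2 + ennreal \<theta> * ennreal (V (X \<omega>)) + ennreal \<theta> * ennreal (V (Y \<omega>)) \<partial>N)"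
    using \<theta> V_nonneg by (intro nn_integral_cong) (simp add: ennreal_plus ennreal_mult')
  also have "\<dots> = 2 + ennreal \<theta> * (\<integral>\<^sup>+\<omega>. ennreal (V (X \<omega>)) \<partial>N) + ennreal \<theta> * (\<integral>\<^sup>+\<omega>. ennreal (V (Y \<omega>)) \<partial>N)"
    by (simp add: nn_integral_add nn_integral_cmult emeasure_space_1)
  also have "\<dots> \<le> 2 + ennreal \<theta> * ennreal b1 + ennreal \<theta> * ennreal b2"
    using b1 b2 by (intro add_mono mult_left_mono) auto
  also have "\<dots> = ennreal (2 + \<theta> * b1 + \<theta> * b2)"
    using \<theta> b1 b2 by (simp add: ennreal_plus ennreal_mult')
  finally have w: "(\<integral>\<^sup>+\<omega>. ennreal (?w \<omega>) \<partial>N) \<le> ennreal (2 + \<theta> * b1 + \<theta> * b2)" .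
  have "(\<integral>\<^sup>+\<omega>. ennreal (dt (X \<omega>) (Y \<omega>)) \<partial>N)\<^sup>2
      = (\<integral>\<^sup>+\<omega>. ennreal (sqrt (d (X \<omega>) (Y \<omega>))) * ennreal (sqrt (?w \<omega>)) \<partial>N)\<^sup>2"
    unfolding dtilde_def using d_nonneg weight_pos
    by (simp add: real_sqrt_mult ennreal_mult less_imp_le)
  also have "\<dots> \<le> (\<integral>\<^sup>+\<omega>. ennreal (sqrt (d (X \<omega>) (Y \<omega>)))^2 \<partial>N) * (\<integral>\<^sup>+\<omega>. ennreal (sqrt (?w \<omega>))^2 \<partial>N)"
    by (rule Cauchy_Schwarz_nn_integral) measurable
  also have "\<dots> = (\<integral>\<^sup>+\<omega>. ennreal (d (X \<omega>) (Y \<omega>)) \<partial>N) * (\<integral>\<^sup>+\<omega>. ennreal (?w \<omega>) \<partial>N)"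
    using d_nonneg weight_pos by (simp add: ennreal_power less_imp_le)
  also have "\<dots> \<le> ennreal a * ennreal (2 + \<theta> * b1 + \<theta> * b2)"
    by (intro mult_mono a w) auto
  also have "\<dots> = ennreal (a * (2 + \<theta> * b1 + \<theta> * b2))"
    using a(2) by (simp add: ennreal_mult')
  finally show ?thesis
    using a(2) b1(2) b2(2) \<theta> by (intro ennreal_power2_le_imp_le_sqrt mult_nonneg_nonneg) auto
qed

lemma nn_integral_dt_le_of_weight:
  assumes N: "prob_space N" and "X \<in> N \<rightarrow>\<^sub>M borel" "Y \<in> N \<rightarrow>\<^sub>M borel"
    and "(\<integral>\<^sup>+\<omega>. ennreal (V (X \<omega>)) \<partial>N) \<le> ennreal b1" "0 \<le> b1"
    and "(\<integral>\<^sup>+\<omega>. ennreal (V (Y \<omega>)) \<partial>N) \<le> ennreal b2" "0 \<le> b2"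
  shows "(\<integral>\<^sup>+\<omega>. ennreal (dt (X \<omega>) (Y \<omega>)) \<partial>N) \<le> ennreal (sqrt (2 + \<theta> * b1 + \<theta> * b2))"
proof -
  interpret prob_space N by fact
  have "(\<integral>\<^sup>+\<omega>. ennreal (d (X \<omega>) (Y \<omega>)) \<partial>N) \<le> (\<integral>\<^sup>+\<omega>. 1 \<partial>N)"
    using d_le_1 by (intro nn_integral_mono) (metis ennreal_1 ennreal_leI)
  then have "(\<integral>\<^sup>+\<omega>. ennreal (d (X \<omega>) (Y \<omega>)) \<partial>N) \<le> ennreal 1"
    by (simp add: emeasure_space_1)
  from nn_integral_dt_le[OF N assms(2,3) this _ assms(4-)] show ?thesis by simp
qed

lemma lip_boundD: "lip_bound L f \<Longrightarrow> norm (f u - f v) \<le> L * dt u v"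
  unfolding lip_bound_def by simp

lemma nn_integral_lip_le:
  assumes f: "lip_bound L f" and L: "0 \<le> L" and [measurable]: "X \<in> N \<rightarrow>\<^sub>M borel" "Y \<in> N \<rightarrow>\<^sub>M borel"
  shows "(\<integral>\<^sup>+\<omega>. ennreal (norm (f (X \<omega>) - f (Y \<omega>))) \<partial>N) \<le> ennreal L * (\<integral>\<^sup>+\<omega>. ennreal (dt (X \<omega>) (Y \<omega>)) \<partial>N)"
proof -
  have [measurable]: "(\<lambda>\<omega>. dt (X \<omega>) (Y \<omega>)) \<in> borel_measurable N"
    using measurable_compose[OF measurable_Pair[of X N borel Y borel] dt_measurable] by simp
  have "(\<integral>\<^sup>+\<omega>. ennreal (norm (f (X \<omega>) - f (Y \<omega>))) \<partial>N) \<le> (\<integral>\<^sup>+\<omega>. ennreal L * ennreal (dt (X \<omega>) (Y \<omega>)) \<partial>N)"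
    using lip_boundD[OF f] L by (intro nn_integral_mono) (simp flip: ennreal_mult' add: ennreal_leI)
  then show ?thesis by (simp add: nn_integral_cmult)
qed

lemma norm_integral_lip_le:
  fixes f :: "'h \<Rightarrow> 'x::{banach, second_countable_topology}"
  assumes f: "lip_bound L f" and L: "0 \<le> L" and X: "X \<in> N \<rightarrow>\<^sub>M borel" and Y: "Y \<in> N \<rightarrow>\<^sub>M borel"
    and fX: "integrable N (\<lambda>\<omega>. f (X \<omega>))" and fY: "integrable N (\<lambda>\<omega>. f (Y \<omega>))"
    and c: "(\<integral>\<^sup>+\<omega>. ennreal (dt (X \<omega>) (Y \<omega>)) \<partial>N) \<le> ennreal c" "0 \<le> c"
  shows "(\<integral>\<omega>. norm (f (X \<omega>) - f (Y \<omega>)) \<partial>N) \<le> L * c"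
    and "norm ((\<integral>\<omega>. f (X \<omega>) \<partial>N) - (\<integral>\<omega>. f (Y \<omega>) \<partial>N)) \<le> L * c"
proof -
  have i: "integrable N (\<lambda>\<omega>. f (X \<omega>) - f (Y \<omega>))" using fX fY by simp
  have "ennreal (\<integral>\<omega>. norm (f (X \<omega>) - f (Y \<omega>)) \<partial>N) = (\<integral>\<^sup>+\<omega>. ennreal (norm (f (X \<omega>) - f (Y \<omega>))) \<partial>N)"
    using i by (intro nn_integral_eq_integral[symmetric]) auto
  also have "\<dots> \<le> ennreal L * ennreal c"
    using nn_integral_lip_le[OF f L X Y] c(1) by (meson mult_left_mono order_trans zero_le)
  finally show *: "(\<integral>\<omega>. norm (f (X \<omega>) - f (Y \<omega>)) \<partial>N) \<le> L * c"
    using L c(2) by (simp flip: ennreal_mult)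
  have "norm ((\<integral>\<omega>. f (X \<omega>) \<partial>N) - (\<integral>\<omega>. f (Y \<omega>) \<partial>N)) = norm (\<integral>\<omega>. f (X \<omega>) - f (Y \<omega>) \<partial>N)"
    using fX fY by simp
  also have "\<dots> \<le> (\<integral>\<omega>. norm (f (X \<omega>) - f (Y \<omega>)) \<partial>N)" by (rule integral_norm_bound)
  finally show "norm ((\<integral>\<omega>. f (X \<omega>) \<partial>N) - (\<integral>\<omega>. f (Y \<omega>) \<partial>N)) \<le> L * c" using * by simp
qed

text \<open>The easy half of Kantorovich duality: integrating \<open>f u - f v\<close> over a coupling compares the two integrals.\<close>
lemma norm_integral_diff_le_wass:
  fixes f :: "'h \<Rightarrow> 'x::{banach, second_countable_topology}"
  assumes f: "lip_bound L f" and L: "0 \<le> L" and fm[measurable]: "f \<in> borel_measurable borel"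
    and f1: "integrable \<mu>1 f" and f2: "integrable \<mu>2 f"
    and w: "wass dt \<mu>1 \<mu>2 \<le> ennreal c" and c: "0 \<le> c"
  shows "norm ((\<integral>u. f u \<partial>\<mu>1) - (\<integral>u. f u \<partial>\<mu>2)) \<le> L * c"
proof (rule field_le_epsilon)
  fix e :: real assume e: "0 < e"
  \<comment> \<open>An optimal coupling need not be at hand, so an almost optimal one is used; \<open>L + 1\<close> covers \<open>L = 0\<close>.\<close>
  define e' where "e' = e / (L + 1)"
  have e': "0 < e'" using e L unfolding e'_def by simp
  have "wass dt \<mu>1 \<mu>2 < ennreal (c + e')"
    using c e' by (intro le_less_trans[OF w]) (simp add: ennreal_less_iff)
  then obtain \<pi> where \<pi>: "\<pi> \<in> couplings \<mu>1 \<mu>2" and le: "(\<integral>\<^sup>+ (u, v). ennreal (dt u v) \<partial>\<pi>) < ennreal (c + e')"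
    unfolding wass_def INF_less_iff by auto
  note m = couplings_marginals(2,3)[OF \<pi>] and d1 = couplings_marginals(4)[OF \<pi>]
    and d2 = couplings_marginals(5)[OF \<pi>]
  have i: "integrable \<pi> (\<lambda>z. f (fst z))" "integrable \<pi> (\<lambda>z. f (snd z))"
    using f1 f2 unfolding d1[symmetric] d2[symmetric]
    by (simp_all add: integrable_distr_eq[OF m(1)] integrable_distr_eq[OF m(2)])
  have "norm ((\<integral>z. f (fst z) \<partial>\<pi>) - (\<integral>z. f (snd z) \<partial>\<pi>)) \<le> L * (c + e')"
    using le c e' by (intro norm_integral_lip_le(2)[OF f L m i]) (auto simp: case_prod_beta' less_imp_le)
  moreover have "(\<integral>z. f (fst z) \<partial>\<pi>) = (\<integral>u. f u \<partial>\<mu>1)" "(\<integral>z. f (snd z) \<partial>\<pi>) = (\<integral>u. f u \<partial>\<mu>2)"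
    unfolding d1[symmetric] d2[symmetric] by (simp_all add: integral_distr[OF m(1)] integral_distr[OF m(2)])
  moreover have "L * e' \<le> e"
    using e L unfolding e'_def by (simp add: field_simps)
  ultimately show "norm ((\<integral>u. f u \<partial>\<mu>1) - (\<integral>u. f u \<partial>\<mu>2)) \<le> L * c + e"
    by (simp add: distrib_left)
qed

lemma first_momentI:
  assumes "prob_space \<mu>" and s: "sets \<mu> = sets borel" and "(\<integral>\<^sup>+u. ennreal (V u) \<partial>\<mu>) < \<infinity>"
  shows "first_moment \<mu>"
proof -
  interpret prob_space \<mu> by fact
  obtain b where b: "0 \<le> b" "(\<integral>\<^sup>+u. ennreal (V u) \<partial>\<mu>) = ennreal b"
    using assms(3) by (metis ennreal_cases infinity_ennreal_def less_irrefl)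
  have "(\<integral>\<^sup>+u. ennreal (dt u 0) \<partial>\<mu>) \<le> ennreal (sqrt (2 + \<theta> * b + \<theta> * V 0))"
    using b V_nonneg[of 0]
    by (intro nn_integral_dt_le_of_weight[OF assms(1)]) (auto simp: measurable_cong_sets[OF s refl] emeasure_space_1)
  then show ?thesis unfolding first_moment_def using assms by (auto simp: le_less_trans)
qed

lemma integrable_lip_bound:
  fixes f :: "'h \<Rightarrow> 'x::{banach, second_countable_topology}"
  assumes \<mu>: "first_moment \<mu>" and f: "lip_bound L f" and L: "0 \<le> L" and fm[measurable]: "f \<in> borel_measurable borel"
  shows "integrable \<mu> f"
proof -
  have s[measurable_cong]: "sets \<mu> = sets borel" and fin: "(\<integral>\<^sup>+u. ennreal (dt u 0) \<partial>\<mu>) < \<infinity>"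
    using \<mu> unfolding first_moment_def by auto
  interpret prob_space \<mu> using \<mu> unfolding first_moment_def by auto
  have "integrable \<mu> (\<lambda>u. f u - f 0)"
  proof (rule integrableI_bounded)
    have "(\<integral>\<^sup>+u. ennreal (norm (f u - f 0)) \<partial>\<mu>) \<le> ennreal L * (\<integral>\<^sup>+u. ennreal (dt u 0) \<partial>\<mu>)"
      by (rule nn_integral_lip_le[OF f L]) measurable
    then show "(\<integral>\<^sup>+u. ennreal (norm (f u - f 0)) \<partial>\<mu>) < \<infinity>"
      using fin by (auto simp: le_less_trans ennreal_mult_less_top)
  qed measurable
  then have "integrable \<mu> (\<lambda>u. (f u - f 0) + f 0)"
    by (intro Bochner_Integration.integrable_add) simp_all
  then show ?thesis by simp
qed

lemma lyapunov_first_moment: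
  assumes "markov_kernel P" "lyapunov_bound P V \<kappa> K"
  shows "first_moment (P u)"
  by (intro first_momentI markov_kernelD[OF assms(1)] le_less_trans[OF lyapunov_boundD(4)[OF assms(2)]]) simp

text \<open>Contraction in \<open>d\<close> gives no contraction in \<open>dt\<close> over one step, but at least a Lipschitz bound. For
\<open>u \<noteq> v\<close> some coupling has expected \<open>d\<close>-cost at most \<open>d u v\<close>: if \<open>d u v < 1\<close> because
\<open>\<gamma>1 * d u v\<close> is strictly smaller, and if \<open>d u v = 1\<close> because every coupling does. The Lyapunov
bound replaces the weight \<open>2 + \<theta> * V u + \<theta> * V v\<close> by at most \<open>1 + \<theta> * K\<close> times itself, and
\<open>nn_integral_dt_le\<close> combines the two.\<close>
lemma wass_contraction_imp_dt_lipschitz: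
  assumes P: "markov_kernel P" and lyap: "lyapunov_bound P V \<kappa> K"
    and contr: "\<And>u v. d u v < 1 \<Longrightarrow> wass d (P u) (P v) \<le> ennreal (\<gamma>1 * d u v)" and \<gamma>1: "0 < \<gamma>1" "\<gamma>1 < 1"
    and uv: "u \<noteq> v"
  shows "wass dt (P u) (P v) \<le> ennreal (sqrt (1 + \<theta> * K) * dt u v)"
proof -
  note \<kappa> = lyapunov_boundD(1-3)[OF lyap] and PV = lyapunov_boundD(4)[OF lyap]
  have dpos: "0 < d u v" using uv d_nonneg d_eq_0 by (simp add: less_le)
  obtain \<pi> where \<pi>: "\<pi> \<in> couplings (P u) (P v)" and le: "(\<integral>\<^sup>+ (x, y). ennreal (d x y) \<partial>\<pi>) \<le> ennreal (d u v)"
  proof (cases "d u v < 1")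
    case True
    have "\<gamma>1 * d u v < d u v" using dpos \<gamma>1 by simp
    then have "wass d (P u) (P v) < ennreal (d u v)"
      using contr[OF True] dpos \<gamma>1 by (intro le_less_trans[OF contr[OF True]]) (simp add: ennreal_less_iff)
    then show ?thesis using that unfolding wass_def INF_less_iff by (auto intro: less_imp_le)
  next
    case False
    then have d1: "d u v = 1" using d_le_1[of u v] by simp
    let ?\<pi> = "P u \<Otimes>\<^sub>M P v"
    have c: "?\<pi> \<in> couplings (P u) (P v)"
      by (intro couplings_product markov_kernelD[OF P])
    then interpret prob_space ?\<pi> unfolding couplings_def by simp
    have "(\<integral>\<^sup>+ (x, y). ennreal (d x y) \<partial>?\<pi>) \<le> (\<integral>\<^sup>+ z. 1 \<partial>?\<pi>)"
      using d_le_1 by (intro nn_integral_mono) (metis (no_types, lifting) case_prod_beta ennreal_1 ennreal_leI)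
    then show ?thesis using that[OF c] d1 by (simp add: emeasure_space_1)
  qed
  note cm = couplings_marginals[OF \<pi>]
  have "(\<integral>\<^sup>+ z. ennreal (dt (fst z) (snd z)) \<partial>\<pi>) \<le>
     ennreal (sqrt (d u v * (2 + \<theta> * (\<kappa> * V u + K) + \<theta> * (\<kappa> * V v + K))))"
  proof (rule nn_integral_dt_le[OF cm(1-3)])
    show "(\<integral>\<^sup>+ z. ennreal (V (fst z)) \<partial>\<pi>) \<le> ennreal (\<kappa> * V u + K)"
      using PV[of u] by (subst cm(6)) auto
    show "(\<integral>\<^sup>+ z. ennreal (V (snd z)) \<partial>\<pi>) \<le> ennreal (\<kappa> * V v + K)"
      using PV[of v] by (subst cm(7)) auto
  qed (use le dpos \<kappa> V_nonneg in \<open>auto simp: case_prod_beta'\<close>)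
  also have "\<dots> \<le> ennreal (sqrt (1 + \<theta> * K) * dt u v)"
  proof (rule ennreal_leI)
    have "2 + \<theta> * (\<kappa> * V u + K) + \<theta> * (\<kappa> * V v + K) \<le> (1 + \<theta> * K) * (2 + \<theta> * V u + \<theta> * V v)"
    proof -
      have "\<kappa> * (\<theta> * V u) \<le> \<theta> * V u" "\<kappa> * (\<theta> * V v) \<le> \<theta> * V v"
        using \<kappa> V_nonneg \<theta> by (auto intro!: mult_left_le_one_le)
      moreover have "0 \<le> (\<theta> * K) * (\<theta> * V u)" "0 \<le> (\<theta> * K) * (\<theta> * V v)"
        using \<kappa> V_nonneg \<theta> by auto
      ultimately show ?thesis by (simp add: algebra_simps)
    qed
    then have "d u v * (2 + \<theta> * (\<kappa> * V u + K) + \<theta> * (\<kappa> * V v + K)) \<le> d u v * ((1 + \<theta> * K) * (2 + \<theta> * V u + \<theta> * V v))"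
      using dpos by (intro mult_left_mono) auto
    then show "sqrt (d u v * (2 + \<theta> * (\<kappa> * V u + K) + \<theta> * (\<kappa> * V v + K))) \<le> sqrt (1 + \<theta> * K) * dt u v"
      unfolding dtilde_def real_sqrt_mult[symmetric] by (simp add: mult.left_commute)
  qed
  finally show ?thesis
    unfolding wass_def using \<pi> by (intro INF_lower2[OF \<pi>]) (simp add: case_prod_beta')
qed

text \<open>An a priori bound on the size of any perturbation, obtained from the product coupling and \<open>d \<le> 1\<close>. It
has the same form \<open>c * (1 + sqrt (V u))\<close> as the perturbation hypothesis, with a constant that depends
on the Lyapunov data only.\<close>
lemma wass_dt_le_of_lyapunov:
  assumes P: "markov_kernel P" and lyap: "lyapunov_bound P V \<kappa> K"
    and P': "markov_kernel P'" and lyap': "lyapunov_bound P' V \<kappa>' K'"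
  shows "wass dt (P u) (P' u) \<le> ennreal ((sqrt (2 + \<theta> * (K + K')) + sqrt (2 * \<theta>)) * (1 + sqrt (V u)))"
proof -
  note \<kappa> = lyapunov_boundD(1-3)[OF lyap] and PV = lyapunov_boundD(4)[OF lyap]
  note \<kappa>' = lyapunov_boundD(1-3)[OF lyap'] and PV' = lyapunov_boundD(4)[OF lyap']
  let ?\<pi> = "P u \<Otimes>\<^sub>M P' u"
  have \<pi>: "?\<pi> \<in> couplings (P u) (P' u)"
    by (intro couplings_product markov_kernelD[OF P] markov_kernelD[OF P'])
  note cm = couplings_marginals[OF \<pi>]
  have "(\<integral>\<^sup>+ z. ennreal (dt (fst z) (snd z)) \<partial>?\<pi>) \<le>
     ennreal (sqrt (2 + \<theta> * (\<kappa> * V u + K) + \<theta> * (\<kappa>' * V u + K')))"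
  proof (rule nn_integral_dt_le_of_weight[OF cm(1-3)])
    show "(\<integral>\<^sup>+ z. ennreal (V (fst z)) \<partial>?\<pi>) \<le> ennreal (\<kappa> * V u + K)"
      using PV[of u] by (subst cm(6)) auto
    show "(\<integral>\<^sup>+ z. ennreal (V (snd z)) \<partial>?\<pi>) \<le> ennreal (\<kappa>' * V u + K')"
      using PV'[of u] by (subst cm(7)) auto
  qed (use \<kappa> \<kappa>' V_nonneg in auto)
  also have "\<dots> \<le> ennreal ((sqrt (2 + \<theta> * (K + K')) + sqrt (2 * \<theta>)) * (1 + sqrt (V u)))"
  proof (rule ennreal_leI)
    have "\<kappa> * (\<theta> * V u) \<le> \<theta> * V u" "\<kappa>' * (\<theta> * V u) \<le> \<theta> * V u"
      using \<kappa> \<kappa>' V_nonneg \<theta> by (auto intro!: mult_left_le_one_le)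
    then have "sqrt (2 + \<theta> * (\<kappa> * V u + K) + \<theta> * (\<kappa>' * V u + K')) \<le> sqrt ((2 + \<theta> * (K + K')) + 2 * \<theta> * V u)"
      by (simp add: algebra_simps)
    also have "\<dots> \<le> sqrt (2 + \<theta> * (K + K')) + sqrt (2 * \<theta> * V u)"
      using \<theta> \<kappa> \<kappa>' V_nonneg by (intro sqrt_add_le_add_sqrt) auto
    also have "\<dots> = sqrt (2 + \<theta> * (K + K')) + sqrt (2 * \<theta>) * sqrt (V u)"
      by (simp add: real_sqrt_mult)
    also have "\<dots> \<le> (sqrt (2 + \<theta> * (K + K')) + sqrt (2 * \<theta>)) * (1 + sqrt (V u))"
      using \<theta> \<kappa> \<kappa>' V_nonneg[of u] by (simp add: distrib_left distrib_right)
    finally show "sqrt (2 + \<theta> * (\<kappa> * V u + K) + \<theta> * (\<kappa>' * V u + K')) \<le> \<dots>" .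
  qed
  finally show ?thesis
    unfolding wass_def by (intro INF_lower2[OF \<pi>]) (simp add: case_prod_beta')
qed

lemma lip_bound_kernel_op:
  fixes f :: "'h \<Rightarrow> 'x::{banach, second_countable_topology}"
  assumes Q: "\<And>u. first_moment (Q u)"
    and w: "\<And>u v. u \<noteq> v \<Longrightarrow> wass dt (Q u) (Q v) \<le> ennreal (c * dt u v)" and c: "0 \<le> c"
    and f: "lip_bound L f" and L: "0 \<le> L" and fm: "f \<in> borel_measurable borel"
  shows "lip_bound (c * L) (kernel_op Q f)"
  unfolding lip_bound_def
proof (intro allI)
  fix u v
  have i: "integrable (Q x) f" for x by (rule integrable_lip_bound[OF Q f L fm])
  show "norm (kernel_op Q f u - kernel_op Q f v) \<le> c * L * dt u v"
  proof (cases "u = v")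
    case False
    then have "norm (kernel_op Q f u - kernel_op Q f v) \<le> L * (c * dt u v)"
      unfolding kernel_op_def
      by (intro norm_integral_diff_le_wass[OF f L fm i i w] mult_nonneg_nonneg c dt_nonneg)
    then show ?thesis by (simp add: mult_ac)
  qed simp
qed

end

section \<open>Averages along a chain with a Lyapunov function\<close>

locale lyapunov_chain = weighted_distance d V \<theta>
  for d :: "'h::{second_countable_topology, zero} \<Rightarrow> 'h \<Rightarrow> real" and V \<theta> +
  fixes P :: "'h \<Rightarrow> 'h measure" and \<kappa> K :: real and M :: "'w measure" and U u0
  assumes P: "markov_kernel P" and lyap: "lyapunov_bound P V \<kappa> K" and chain: "markov_chain M U P u0"
begin

sublocale prob_space M using chain unfolding markov_chain_def by simp

text \<open>A bound for the expectation of \<open>V\<close> at every time.\<close>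
definition V_sup :: real where "V_sup = V u0 + K / (1 - \<kappa>)"

text \<open>A bound for the expected \<open>dt\<close>-distance between any two states of the chain, from \<open>d \<le> 1\<close>.\<close>
definition dt_scale :: real where "dt_scale = sqrt (2 + 2 * \<theta> * V_sup)"

lemma U_measurable[measurable]: "U k \<in> M \<rightarrow>\<^sub>M borel"
  using chain unfolding markov_chain_def by simp

lemma \<kappa>: "0 < \<kappa>" "\<kappa> < 1" and K: "0 < K"
  using lyapunov_boundD[OF lyap] by auto

lemma nn_integral_V_le: "(\<integral>\<^sup>+\<omega>. ennreal (V (U k \<omega>)) \<partial>M) \<le> ennreal (\<kappa> ^ k * V u0 + K / (1 - \<kappa>))"
proof (induction k)
  case 0
  have "AE \<omega> in M. U 0 \<omega> = u0" using chain unfolding markov_chain_def by simp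
  then have "(\<integral>\<^sup>+\<omega>. ennreal (V (U 0 \<omega>)) \<partial>M) = (\<integral>\<^sup>+\<omega>. ennreal (V u0) \<partial>M)"
    by (intro nn_integral_cong_AE) auto
  also have "\<dots> \<le> ennreal (V u0 + K / (1 - \<kappa>))"
    using \<kappa> K by (simp add: emeasure_space_1 ennreal_leI)
  finally show ?case by simp
next
  case (Suc k)
  have "(\<integral>\<^sup>+\<omega>. ennreal (V (U (Suc k) \<omega>)) \<partial>M) = (\<integral>\<^sup>+\<omega>. \<integral>\<^sup>+y. ennreal (V y) \<partial>P (U k \<omega>) \<partial>M)"
    by (rule markov_chain_nn_integral[OF chain P, of "\<lambda>_ y. ennreal (V y)"]) measurable
  also have "\<dots> \<le> (\<integral>\<^sup>+\<omega>. ennreal \<kappa> * ennreal (V (U k \<omega>)) + ennreal K \<partial>M)"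
    using lyapunov_boundD(4)[OF lyap] \<kappa> K V_nonneg
    by (intro nn_integral_mono) (simp add: ennreal_mult' ennreal_plus)
  also have "\<dots> = ennreal \<kappa> * (\<integral>\<^sup>+\<omega>. ennreal (V (U k \<omega>)) \<partial>M) + ennreal K"
    by (simp add: nn_integral_add nn_integral_cmult emeasure_space_1)
  also have "\<dots> \<le> ennreal \<kappa> * ennreal (\<kappa> ^ k * V u0 + K / (1 - \<kappa>)) + ennreal K"
    by (intro add_right_mono mult_left_mono Suc) simp
  also have "\<dots> = ennreal (\<kappa> * (\<kappa> ^ k * V u0 + K / (1 - \<kappa>)) + K)"
    using \<kappa> K V_nonneg[of u0] by (subst ennreal_plus) (auto simp: ennreal_mult')
  also have "\<kappa> * (\<kappa> ^ k * V u0 + K / (1 - \<kappa>)) + K = \<kappa> ^ Suc k * V u0 + K / (1 - \<kappa>)"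
    using \<kappa> by (simp add: field_simps)
  finally show ?case .
qed

lemma V_sup_nonneg: "0 \<le> V_sup"
  unfolding V_sup_def using V_nonneg[of u0] \<kappa> K by simp

lemma nn_integral_V_le_sup: "(\<integral>\<^sup>+\<omega>. ennreal (V (U k \<omega>)) \<partial>M) \<le> ennreal V_sup"
proof -
  have "\<kappa> ^ k * V u0 \<le> 1 * V u0"
    using \<kappa> V_nonneg by (intro mult_right_mono power_le_one) auto
  then show ?thesis
    unfolding V_sup_def by (intro order_trans[OF nn_integral_V_le] ennreal_leI) simp
qed

lemma V_integrable: "integrable M (\<lambda>\<omega>. V (U k \<omega>))"
  using V_nonneg le_less_trans[OF nn_integral_V_le_sup] by (intro integrableI_nonneg) auto

lemma expectation_V_le: "expectation (\<lambda>\<omega>. V (U k \<omega>)) \<le> \<kappa> ^ k * V u0 + K / (1 - \<kappa>)"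
proof -
  have "ennreal (expectation (\<lambda>\<omega>. V (U k \<omega>))) = (\<integral>\<^sup>+\<omega>. ennreal (V (U k \<omega>)) \<partial>M)"
    using V_nonneg V_integrable by (intro nn_integral_eq_integral[symmetric]) auto
  also note nn_integral_V_le
  finally show ?thesis
    using \<kappa> K V_nonneg[of u0] by (subst (asm) ennreal_le_iff) auto
qed

lemma expectation_V_le_sup: "expectation (\<lambda>\<omega>. V (U k \<omega>)) \<le> V_sup"
proof -
  have "\<kappa> ^ k * V u0 \<le> 1 * V u0"
    using \<kappa> V_nonneg by (intro mult_right_mono power_le_one) auto
  then show ?thesis
    unfolding V_sup_def by (intro order_trans[OF expectation_V_le]) simp
qed

lemma first_moment_law: "first_moment (distr M borel (U k))"
  using le_less_trans[OF nn_integral_V_le_sup[of k]]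
  by (intro first_momentI prob_space_distr) (simp_all add: nn_integral_distr)

lemma expectation_dt_le:
  shows "integrable M (\<lambda>\<omega>. dt (U k \<omega>) x)"
    and "expectation (\<lambda>\<omega>. dt (U k \<omega>) x) \<le> sqrt (2 + \<theta> * V_sup + \<theta> * V x)"
proof -
  have [measurable]: "(\<lambda>u. dt u x) \<in> borel_measurable borel"
    using measurable_compose[OF measurable_Pair[of "\<lambda>v. v" borel borel "\<lambda>_. x" borel] dt_measurable] by simp
  have le: "(\<integral>\<^sup>+\<omega>. ennreal (dt (U k \<omega>) x) \<partial>M) \<le> ennreal (sqrt (2 + \<theta> * V_sup + \<theta> * V x))"
    by (intro nn_integral_dt_le_of_weight prob_space_axioms U_measurable nn_integral_V_le_sup V_sup_nonneg V_nonneg)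
       (simp_all add: emeasure_space_1)
  then show i: "integrable M (\<lambda>\<omega>. dt (U k \<omega>) x)"
    using dt_nonneg le_less_trans[OF le] by (intro integrableI_nonneg) auto
  have "ennreal (expectation (\<lambda>\<omega>. dt (U k \<omega>) x)) = (\<integral>\<^sup>+\<omega>. ennreal (dt (U k \<omega>) x) \<partial>M)"
    using i dt_nonneg by (intro nn_integral_eq_integral[symmetric]) auto
  also note le
  finally show "expectation (\<lambda>\<omega>. dt (U k \<omega>) x) \<le> sqrt (2 + \<theta> * V_sup + \<theta> * V x)"
    using \<theta> V_sup_nonneg V_nonneg[of x] by (subst (asm) ennreal_le_iff) auto
qed

lemma integrable_lip_chain:
  fixes f :: "'h \<Rightarrow> 'x::{banach, second_countable_topology}"
  assumes "lip_bound L f" "0 \<le> L" "f \<in> borel_measurable borel"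
  shows "integrable M (\<lambda>\<omega>. f (U k \<omega>))"
  using integrable_lip_bound[OF first_moment_law assms] assms(3) by (simp add: integrable_distr_eq)

text \<open>Taking the root after the geometric decay separates the influence of \<open>V u0\<close>, which is summable in \<open>k\<close>, from a
part that is independent of the starting point.\<close>
lemma expectation_sqrt_V_le:
  shows "integrable M (\<lambda>\<omega>. sqrt (V (U k \<omega>)))"
    and "expectation (\<lambda>\<omega>. sqrt (V (U k \<omega>))) \<le> sqrt \<kappa> ^ k * sqrt (V u0) + sqrt (K / (1 - \<kappa>))"
proof -
  have sq: "(\<lambda>\<omega>. (sqrt (V (U k \<omega>)))\<^sup>2) = (\<lambda>\<omega>. V (U k \<omega>))" using V_nonneg by simp
  show i: "integrable M (\<lambda>\<omega>. sqrt (V (U k \<omega>)))"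
    by (rule square_integrable_imp_integrable) (simp_all add: sq V_integrable)
  have "(expectation (\<lambda>\<omega>. sqrt (V (U k \<omega>))))\<^sup>2 \<le> expectation (\<lambda>\<omega>. V (U k \<omega>))"
    using variance_eq[OF i] variance_positive[of "\<lambda>\<omega>. sqrt (V (U k \<omega>))"] V_integrable[of k] unfolding sq by simp
  then have "expectation (\<lambda>\<omega>. sqrt (V (U k \<omega>))) \<le> sqrt (expectation (\<lambda>\<omega>. V (U k \<omega>)))"
    by (rule real_le_rsqrt)
  also have "\<dots> \<le> sqrt (\<kappa> ^ k * V u0 + K / (1 - \<kappa>))"
    using expectation_V_le by simp
  also have "\<dots> \<le> sqrt (\<kappa> ^ k * V u0) + sqrt (K / (1 - \<kappa>))"
    using \<kappa> K V_nonneg by (intro sqrt_add_le_add_sqrt) auto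
  finally show "expectation (\<lambda>\<omega>. sqrt (V (U k \<omega>))) \<le> sqrt \<kappa> ^ k * sqrt (V u0) + sqrt (K / (1 - \<kappa>))"
    by (simp add: real_sqrt_mult real_sqrt_power)
qed

lemma sum_expectation_sqrt_V_le:
  "(\<Sum>k<n. expectation (\<lambda>\<omega>. 1 + sqrt (V (U k \<omega>)))) \<le> real n * (1 + sqrt (K / (1 - \<kappa>))) + sqrt (V u0) / (1 - sqrt \<kappa>)"
proof -
  have s: "0 < sqrt \<kappa>" "sqrt \<kappa> < 1" using \<kappa> by auto
  have "(\<Sum>k<n. expectation (\<lambda>\<omega>. 1 + sqrt (V (U k \<omega>)))) \<le> (\<Sum>k<n. sqrt \<kappa> ^ k * sqrt (V u0) + (1 + sqrt (K / (1 - \<kappa>))))"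
    using expectation_sqrt_V_le by (intro sum_mono) (simp add: prob_space algebra_simps)
  also have "\<dots> = (\<Sum>k<n. sqrt \<kappa> ^ k) * sqrt (V u0) + real n * (1 + sqrt (K / (1 - \<kappa>)))"
    by (simp add: sum.distrib sum_distrib_right)
  also have "(\<Sum>k<n. sqrt \<kappa> ^ k) * sqrt (V u0) \<le> 1 / (1 - sqrt \<kappa>) * sqrt (V u0)"
  proof (rule mult_right_mono)
    have "(\<Sum>k<n. sqrt \<kappa> ^ k) \<le> (\<Sum>k. sqrt \<kappa> ^ k)"
      using s by (intro sum_le_suminf summable_geometric) auto
    then show "(\<Sum>k<n. sqrt \<kappa> ^ k) \<le> 1 / (1 - sqrt \<kappa>)"
      using s by (simp add: suminf_geometric)
  qed (simp add: V_nonneg)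
  finally show ?thesis by simp
qed

lemma boundary_term_le:
  fixes F :: "'h \<Rightarrow> 'x::{banach, second_countable_topology}"
  assumes F: "lip_bound L F" "0 \<le> L" "F \<in> borel_measurable borel"
  shows "expectation (\<lambda>\<omega>. norm (F (U i \<omega>) - F (U j \<omega>))) \<le> L * dt_scale"
proof -
  have "(\<integral>\<^sup>+\<omega>. ennreal (dt (U i \<omega>) (U j \<omega>)) \<partial>M) \<le> ennreal (sqrt (2 + \<theta> * V_sup + \<theta> * V_sup))"
    by (intro nn_integral_dt_le_of_weight prob_space_axioms U_measurable nn_integral_V_le_sup V_sup_nonneg)
  also have "sqrt (2 + \<theta> * V_sup + \<theta> * V_sup) = dt_scale" by (simp add: dt_scale_def)
  finally show ?thesis
    using \<theta> V_sup_nonneg integrable_lip_chain[OF F]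
    by (intro norm_integral_lip_le(1)[OF F(1,2)] U_measurable) (auto simp: dt_scale_def)
qed

definition increment :: "('h \<Rightarrow> 'x::{banach, second_countable_topology}) \<Rightarrow> nat \<Rightarrow> 'w \<Rightarrow> 'x" where
  "increment F k \<omega> = F (U (Suc k) \<omega>) - kernel_op P F (U k \<omega>)"

context
  fixes F :: "'h \<Rightarrow> 'x::{real_inner, banach, second_countable_topology}" and L :: real
  assumes F: "lip_bound L F" "0 \<le> L" and Fm[measurable]: "F \<in> borel_measurable borel"
begin

lemma PF_measurable[measurable]: "kernel_op P F \<in> borel_measurable borel"
  by (rule kernel_op_measurable[OF P Fm])

lemma integrable_P: "integrable (P u) F"
  by (rule integrable_lip_bound[OF lyapunov_first_moment[OF P lyap] F Fm])

lemma increment_measurable[measurable]: "increment F k \<in> borel_measurable M"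
  unfolding increment_def by measurable

text \<open>Given the present state, the increment is the difference of \<open>F\<close> at the next state and its mean over the kernel, so
it is bounded by \<open>L\<close> times the mean \<open>dt\<close>-distance from the next state to an independent copy of it.\<close>
lemma increment_square_le:
  "(norm (increment F k \<omega>))\<^sup>2 \<le> L\<^sup>2 * (2 + \<theta> * V (U (Suc k) \<omega>) + \<theta> * (\<kappa> * V (U k \<omega>) + K))"
proof -
  let ?y = "U (Suc k) \<omega>" and ?u = "U k \<omega>"
  let ?b = "2 + \<theta> * V ?y + \<theta> * (\<kappa> * V ?u + K)"
  interpret Pu: prob_space "P ?u" by (rule markov_kernelD[OF P])
  have nn: "0 \<le> \<kappa> * V ?u + K" using \<kappa> K V_nonneg by simp
  have m: "(\<lambda>z. z) \<in> P ?u \<rightarrow>\<^sub>M borel"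
    by (simp add: measurable_cong_sets[OF markov_kernelD(2)[OF P] refl])
  have "(\<integral>\<^sup>+z. ennreal (dt ?y z) \<partial>P ?u) \<le> ennreal (sqrt ?b)"
    using lyapunov_boundD(4)[OF lyap, of ?u] nn V_nonneg[of ?y]
    by (intro nn_integral_dt_le_of_weight Pu.prob_space_axioms m) (auto simp: Pu.emeasure_space_1)
  then have "norm ((\<integral>z. F ?y \<partial>P ?u) - (\<integral>z. F z \<partial>P ?u)) \<le> L * sqrt ?b"
    using integrable_P nn \<theta> V_nonneg[of ?y] by (intro norm_integral_lip_le(2)[OF F _ m]) auto
  then have "norm (increment F k \<omega>) \<le> L * sqrt ?b"
    by (simp add: increment_def kernel_op_def Pu.prob_space)
  then have "(norm (increment F k \<omega>))\<^sup>2 \<le> (L * sqrt ?b)\<^sup>2"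
    by (intro power_mono) auto
  also have "\<dots> = L\<^sup>2 * ?b"
    using nn \<theta> V_nonneg[of ?y] by (simp add: power_mult_distrib)
  finally show ?thesis .
qed

lemma increment_bound_integrable:
  "integrable M (\<lambda>\<omega>. L\<^sup>2 * (2 + \<theta> * V (U (Suc k) \<omega>) + \<theta> * (\<kappa> * V (U k \<omega>) + K)))"
  using V_integrable[of k] V_integrable[of "Suc k"]
  by (intro Bochner_Integration.integrable_add integrable_mult_right integrable_const) auto

lemma increment_square_integrable: "integrable M (\<lambda>\<omega>. (norm (increment F k \<omega>))\<^sup>2)"
proof (rule Bochner_Integration.integrable_bound[OF increment_bound_integrable[of k]])
  show "AE \<omega> in M. norm ((norm (increment F k \<omega>))\<^sup>2)
      \<le> norm (L\<^sup>2 * (2 + \<theta> * V (U (Suc k) \<omega>) + \<theta> * (\<kappa> * V (U k \<omega>) + K)))"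
    using order_trans[OF increment_square_le abs_ge_self] by simp
qed measurable

lemma expectation_increment_square_le:
  "expectation (\<lambda>\<omega>. (norm (increment F k \<omega>))\<^sup>2) \<le> L\<^sup>2 * dt_scale\<^sup>2"
proof -
  have "expectation (\<lambda>\<omega>. (norm (increment F k \<omega>))\<^sup>2)
      \<le> expectation (\<lambda>\<omega>. L\<^sup>2 * (2 + \<theta> * V (U (Suc k) \<omega>) + \<theta> * (\<kappa> * V (U k \<omega>) + K)))"
    by (intro integral_mono increment_square_integrable increment_square_le increment_bound_integrable)
  also have "\<dots> = L\<^sup>2 * (2 + \<theta> * expectation (\<lambda>\<omega>. V (U (Suc k) \<omega>)) + \<theta> * (\<kappa> * expectation (\<lambda>\<omega>. V (U k \<omega>)) + K))"
    using V_integrable by (simp add: prob_space)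
  also have "\<dots> \<le> L\<^sup>2 * (2 + \<theta> * V_sup + \<theta> * V_sup)"
  proof -
    have "\<kappa> * expectation (\<lambda>\<omega>. V (U k \<omega>)) + K \<le> \<kappa> * V_sup + K"
      using expectation_V_le_sup \<kappa> by simp
    also have "\<dots> = \<kappa> * V u0 + K / (1 - \<kappa>)"
      unfolding V_sup_def using \<kappa> by (simp add: field_simps)
    also have "\<dots> \<le> V_sup"
      unfolding V_sup_def using \<kappa> V_nonneg by (simp add: mult_left_le_one_le)
    finally show ?thesis
      using expectation_V_le_sup \<theta> by (intro mult_left_mono add_mono) auto
  qed
  also have "\<dots> = L\<^sup>2 * dt_scale\<^sup>2"
    unfolding dt_scale_def using \<theta> V_sup_nonneg by simp
  finally show ?thesis .
qed

lemma increment_integrable: "integrable M (increment F k)"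
proof -
  have "integrable M (\<lambda>\<omega>. norm (increment F k \<omega>))"
    by (rule square_integrable_imp_integrable) (auto intro: increment_square_integrable)
  then show ?thesis by (simp add: integrable_norm_iff)
qed

text \<open>A vector orthogonal to itself vanishes: pair the increment with its own expectation.\<close>
lemma expectation_increment: "expectation (increment F k) = 0"
proof -
  let ?w = "expectation (increment F k)"
  have "expectation (\<lambda>\<omega>. ?w \<bullet> increment F k \<omega>) = 0"
    using integrable_inner_right[OF increment_integrable, of ?w k]
    unfolding increment_def kernel_op_def
    by (intro markov_chain_increment_orthogonal[OF chain P Fm integrable_P]) auto
  then have "?w \<bullet> ?w = 0"
    using increment_integrable[of k] by simp
  then show ?thesis by simp
qed

lemma sum_increment_past_measurable:
  "(\<lambda>\<omega>. \<Sum>k<n. increment F k \<omega>) \<in> borel_measurable (past M U n)"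
proof (intro borel_measurable_sum)
  fix k assume "k \<in> {..<n}"
  then have [measurable]: "U k \<in> past M U n \<rightarrow>\<^sub>M borel" "U (Suc k) \<in> past M U n \<rightarrow>\<^sub>M borel"
    by (auto intro: measurable_past)
  show "increment F k \<in> borel_measurable (past M U n)"
    unfolding increment_def by measurable
qed

text \<open>Pythagoras for martingale increments, which is where the inner product of the target space enters. The bound
grows like \<open>n\<close> rather than \<open>n^2\<close>, and this yields the rate \<open>1 / sqrt n\<close>.\<close>
lemma expectation_sum_increment_square_le:
  "integrable M (\<lambda>\<omega>. (norm (\<Sum>k<n. increment F k \<omega>))\<^sup>2) \<and>
   expectation (\<lambda>\<omega>. (norm (\<Sum>k<n. increment F k \<omega>))\<^sup>2) \<le> real n * (L\<^sup>2 * dt_scale\<^sup>2)"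
proof (induction n)
  case (Suc n)
  let ?S = "\<lambda>\<omega>. \<Sum>k<n. increment F k \<omega>" and ?D = "increment F n"
  have eq: "(norm (\<Sum>k<Suc n. increment F k \<omega>))\<^sup>2 = (norm (?S \<omega>))\<^sup>2 + 2 * (?S \<omega> \<bullet> ?D \<omega>) + (norm (?D \<omega>))\<^sup>2" for \<omega>
    by (simp add: power2_norm_eq_inner inner_add inner_commute)
  have i: "integrable M (\<lambda>\<omega>. ?S \<omega> \<bullet> ?D \<omega>)"
  proof (rule Bochner_Integration.integrable_bound)
    show "integrable M (\<lambda>\<omega>. (norm (?S \<omega>))\<^sup>2 + (norm (?D \<omega>))\<^sup>2)"
      using Suc.IH increment_square_integrable by simp
    show "AE \<omega> in M. norm (?S \<omega> \<bullet> ?D \<omega>) \<le> norm ((norm (?S \<omega>))\<^sup>2 + (norm (?D \<omega>))\<^sup>2)"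
    proof (rule AE_I2)
      fix \<omega>
      have "norm (?S \<omega> \<bullet> ?D \<omega>) \<le> norm (?S \<omega>) * norm (?D \<omega>)"
        using Cauchy_Schwarz_ineq2 by simp
      also have "\<dots> \<le> (norm (?S \<omega>))\<^sup>2 + (norm (?D \<omega>))\<^sup>2"
        using sum_squares_bound[of "norm (?S \<omega>)" "norm (?D \<omega>)"] norm_ge_zero[of "?S \<omega>"] norm_ge_zero[of "?D \<omega>"]
          mult_nonneg_nonneg[of "norm (?S \<omega>)" "norm (?D \<omega>)"] by linarith
      finally show "norm (?S \<omega> \<bullet> ?D \<omega>) \<le> norm ((norm (?S \<omega>))\<^sup>2 + (norm (?D \<omega>))\<^sup>2)" by simp
    qed
  qed measurable
  have z: "expectation (\<lambda>\<omega>. ?S \<omega> \<bullet> ?D \<omega>) = 0"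
    using i unfolding increment_def[of F n] kernel_op_def
    by (intro markov_chain_increment_orthogonal[OF chain P Fm integrable_P sum_increment_past_measurable])
  have "expectation (\<lambda>\<omega>. (norm (\<Sum>k<Suc n. increment F k \<omega>))\<^sup>2)
      = expectation (\<lambda>\<omega>. (norm (?S \<omega>))\<^sup>2) + expectation (\<lambda>\<omega>. (norm (?D \<omega>))\<^sup>2)"
    unfolding eq using i z Suc.IH increment_square_integrable[of n] by simp
  moreover have "integrable M (\<lambda>\<omega>. (norm (\<Sum>k<Suc n. increment F k \<omega>))\<^sup>2)"
    unfolding eq using i Suc.IH increment_square_integrable[of n] by simp
  ultimately show ?case
    using Suc.IH expectation_increment_square_le[of n] by (simp add: distrib_right)
qed simp

lemma expectation_norm_sum_increment_le:
  "expectation (\<lambda>\<omega>. norm (\<Sum>k<n. increment F k \<omega>)) \<le> L * dt_scale * sqrt (real n)"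
proof -
  let ?S = "\<lambda>\<omega>. norm (\<Sum>k<n. increment F k \<omega>)"
  note * = expectation_sum_increment_square_le[of n]
  have i: "integrable M ?S" by (rule square_integrable_imp_integrable) (use * in auto)
  have "(expectation ?S)\<^sup>2 \<le> expectation (\<lambda>\<omega>. (?S \<omega>)\<^sup>2)"
    using variance_eq[OF i] variance_positive[of ?S] * by simp
  also have "\<dots> \<le> (L * dt_scale * sqrt (real n))\<^sup>2"
    using * by (simp add: power_mult_distrib mult_ac)
  finally show ?thesis
    by (rule power2_le_imp_le) (use F \<theta> V_sup_nonneg in \<open>auto simp: dt_scale_def\<close>)
qed

text \<open>The decomposition of the ergodic average for an approximate solution \<open>F\<close> of the Poisson equation. The function
\<open>H\<close> plays the role of \<open>P0 F\<close>, so that \<open>H\<close> is close to \<open>P F\<close>, and \<open>R\<close> is the remainder of the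
equation. Both estimates use the same terms; in the second one the martingale part has
expectation zero, which removes \<open>dt_scale / sqrt n\<close>.\<close>
lemma ergodic_average_le:
  fixes f H R :: "'h \<Rightarrow> 'x" and a :: 'x
  assumes decomp: "\<And>u. f u - a = F u - H u + R u"
    and H: "\<And>u. norm (kernel_op P F u - H u) \<le> L * q * (1 + sqrt (V u))" and q: "0 \<le> q"
    and Hm[measurable]: "H \<in> borel_measurable borel"
    and fi: "\<And>k. integrable M (\<lambda>\<omega>. f (U k \<omega>))"
    and Ri: "\<And>k. integrable M (\<lambda>\<omega>. R (U k \<omega>))" and Rb: "\<And>k. expectation (\<lambda>\<omega>. norm (R (U k \<omega>))) \<le> \<rho>"
    and n: "1 \<le> n"
  defines "A \<equiv> \<lambda>\<omega>. (1 / real n) *\<^sub>R (\<Sum>k<n. f (U k \<omega>))"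
  shows "expectation (\<lambda>\<omega>. norm (A \<omega> - a)) \<le>
      L * (q * (1 + sqrt (K / (1 - \<kappa>))) + (q * (sqrt (V u0) / (1 - sqrt \<kappa>)) + dt_scale) / n + dt_scale / sqrt n) + \<rho>"
    and "norm (expectation A - a) \<le>
      L * (q * (1 + sqrt (K / (1 - \<kappa>))) + (q * (sqrt (V u0) / (1 - sqrt \<kappa>)) + dt_scale) / n) + \<rho>"
proof -
  let ?\<alpha> = "1 + sqrt (K / (1 - \<kappa>))" and ?\<beta> = "sqrt (V u0) / (1 - sqrt \<kappa>)"
  define B where "B \<omega> = F (U 0 \<omega>) - F (U n \<omega>)" for \<omega>
  define S where "S \<omega> = (\<Sum>k<n. increment F k \<omega>)" for \<omega>
  define E where "E k \<omega> = kernel_op P F (U k \<omega>) - H (U k \<omega>)" for k \<omega>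
  define T where "T \<omega> = B \<omega> + (\<Sum>k<n. E k \<omega>) + (\<Sum>k<n. R (U k \<omega>))" for \<omega>
  have split: "(\<Sum>k<n. f (U k \<omega>) - a) = S \<omega> + T \<omega>" for \<omega>
  proof -
    have "(\<Sum>k<n. f (U k \<omega>) - a)
        = (\<Sum>k<n. (F (U k \<omega>) - F (U (Suc k) \<omega>)) + increment F k \<omega> + E k \<omega> + R (U k \<omega>))"
      unfolding increment_def E_def decomp by (intro sum.cong) auto
    also have "\<dots> = S \<omega> + T \<omega>"
      unfolding S_def T_def B_def sum.distrib sum_lessThan_telescope'[of "\<lambda>k. F (U k \<omega>)"] by (simp add: add_ac)
    finally show ?thesis .
  qed
  have AS: "A \<omega> - a = (1 / real n) *\<^sub>R (S \<omega> + T \<omega>)" for \<omega>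
    unfolding split[symmetric] A_def using n
    by (simp add: sum_subtractf scaleR_diff_right sum_constant_scaleR)
  have iB: "integrable M B"
    unfolding B_def by (intro Bochner_Integration.integrable_diff integrable_lip_chain[OF F Fm])
  have iS: "integrable M S"
    unfolding S_def by (intro Bochner_Integration.integrable_sum increment_integrable)
  have iE: "integrable M (E k)" for k
  proof (rule Bochner_Integration.integrable_bound)
    show "integrable M (\<lambda>\<omega>. L * q * (1 + sqrt (V (U k \<omega>))))"
      using expectation_sqrt_V_le by auto
    show "AE \<omega> in M. norm (E k \<omega>) \<le> norm (L * q * (1 + sqrt (V (U k \<omega>))))"
      unfolding E_def real_norm_def by (intro AE_I2 order_trans[OF H abs_ge_self])
  qed (unfold E_def, measurable)
  have iT: "integrable M T"
    unfolding T_def using iB iE Ri by auto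
  have E_le: "expectation (\<lambda>\<omega>. norm (E k \<omega>)) \<le> L * q * expectation (\<lambda>\<omega>. 1 + sqrt (V (U k \<omega>)))" for k
  proof -
    have "expectation (\<lambda>\<omega>. norm (E k \<omega>)) \<le> expectation (\<lambda>\<omega>. L * q * (1 + sqrt (V (U k \<omega>))))"
    proof (rule integral_mono)
      show "integrable M (\<lambda>\<omega>. norm (E k \<omega>))" using iE by simp
    qed (use H expectation_sqrt_V_le(1) in \<open>auto simp: E_def\<close>)
    then show ?thesis by simp
  qed
  have "expectation (\<lambda>\<omega>. norm (T \<omega>))
      \<le> expectation (\<lambda>\<omega>. norm (B \<omega>) + (\<Sum>k<n. norm (E k \<omega>)) + (\<Sum>k<n. norm (R (U k \<omega>))))"
    unfolding T_def using iB iE Ri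
    by (intro integral_mono) (auto intro!: norm_triangle_le add_mono norm_sum)
  also have "\<dots> = expectation (\<lambda>\<omega>. norm (B \<omega>)) + (\<Sum>k<n. expectation (\<lambda>\<omega>. norm (E k \<omega>)))
      + (\<Sum>k<n. expectation (\<lambda>\<omega>. norm (R (U k \<omega>))))"
    using iB iE Ri by simp
  also have "\<dots> \<le> L * dt_scale + (\<Sum>k<n. L * q * expectation (\<lambda>\<omega>. 1 + sqrt (V (U k \<omega>)))) + (\<Sum>k<n. \<rho>)"
    by (intro add_mono sum_mono E_le Rb) (auto simp: B_def intro!: boundary_term_le[OF F Fm])
  also have "\<dots> \<le> L * dt_scale + L * q * (real n * ?\<alpha> + ?\<beta>) + real n * \<rho>"
    unfolding sum_distrib_left[symmetric]
    using sum_expectation_sqrt_V_le[of n] F(2) q by (intro add_mono mult_left_mono) auto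
  finally have T: "expectation (\<lambda>\<omega>. norm (T \<omega>)) \<le> \<dots>" .
  have T_n: "expectation (\<lambda>\<omega>. norm (T \<omega>)) / n \<le> L * (q * ?\<alpha> + (q * ?\<beta> + dt_scale) / n) + \<rho>"
  proof -
    have "L * dt_scale + L * q * (real n * ?\<alpha> + ?\<beta>) + real n * \<rho>
       = n * (L * (q * ?\<alpha> + (q * ?\<beta> + dt_scale) / n) + \<rho>)"
      using n by (simp add: field_simps)
    with T show ?thesis using n by (simp add: divide_le_eq mult.commute)
  qed
  have "expectation (\<lambda>\<omega>. norm (A \<omega> - a)) = expectation (\<lambda>\<omega>. norm (S \<omega> + T \<omega>)) / n"
    unfolding AS by simp
  also have "\<dots> \<le> (expectation (\<lambda>\<omega>. norm (S \<omega>)) + expectation (\<lambda>\<omega>. norm (T \<omega>))) / n"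
  proof (rule divide_right_mono)
    have "expectation (\<lambda>\<omega>. norm (S \<omega> + T \<omega>)) \<le> expectation (\<lambda>\<omega>. norm (S \<omega>) + norm (T \<omega>))"
      using iS iT by (intro integral_mono) (auto intro: norm_triangle_ineq)
    then show "expectation (\<lambda>\<omega>. norm (S \<omega> + T \<omega>)) \<le> expectation (\<lambda>\<omega>. norm (S \<omega>)) + expectation (\<lambda>\<omega>. norm (T \<omega>))"
      using iS iT by simp
  qed simp
  also have "\<dots> \<le> L * dt_scale * sqrt (real n) / n + (L * (q * ?\<alpha> + (q * ?\<beta> + dt_scale) / n) + \<rho>)"
    unfolding add_divide_distrib[of "expectation (\<lambda>\<omega>. norm (S \<omega>))"] using n expectation_norm_sum_increment_le[of n]
    by (intro add_mono T_n divide_right_mono) (auto simp: S_def)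
  also have "L * dt_scale * sqrt (real n) / n = L * (dt_scale / sqrt n)"
    using sqrt_divide_self_eq[of "real n"] by (simp add: divide_inverse mult.assoc)
  finally show "expectation (\<lambda>\<omega>. norm (A \<omega> - a)) \<le>
      L * (q * ?\<alpha> + (q * ?\<beta> + dt_scale) / n + dt_scale / sqrt n) + \<rho>"
    by (simp add: distrib_left)
  have eS: "expectation S = 0"
    unfolding S_def using increment_integrable expectation_increment by simp
  have iA: "integrable M A" unfolding A_def using fi by auto
  have "expectation A - a = expectation (\<lambda>\<omega>. A \<omega> - a)"
    using iA by (simp add: prob_space)
  also have "\<dots> = (1 / real n) *\<^sub>R expectation T"
    unfolding AS using iS iT eS by simp
  finally have "norm (expectation A - a) = norm (expectation T) / n"
    by simp
  also have "\<dots> \<le> expectation (\<lambda>\<omega>. norm (T \<omega>)) / n"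
    by (intro divide_right_mono integral_norm_bound) simp
  also note T_n
  finally show "norm (expectation A - a) \<le> L * (q * ?\<alpha> + (q * ?\<beta> + dt_scale) / n) + \<rho>" .
qed

end

end

section \<open>An approximate solution of the Poisson equation\<close>

lemma kernel_iter_markov_kernel:
  assumes "markov_kernel P"
  shows "markov_kernel (kernel_iter P k)"
proof (induction k)
  case 0
  then show ?case
    unfolding markov_kernel_def using measurable_return_prob_space[of borel] by (simp add: fun_eq_iff cong: measurable_cong)
next
  case (Suc k)
  have "kernel_iter P (Suc k) = (\<lambda>u. bind (kernel_iter P k u) P)" by (simp add: fun_eq_iff)
  then show ?case
    using Suc assms measurable_bind_prob_space unfolding markov_kernel_def by metis
qed

context weighted_distance
begin

lemma dt_sym: "dt u v = dt v u"
  using dl unfolding distance_like_def dtilde_def by (simp add: add_ac)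

lemma lip_bound_sum:
  assumes "\<And>i. i \<in> I \<Longrightarrow> lip_bound (L i) (f i)"
  shows "lip_bound (\<Sum>i\<in>I. L i) (\<lambda>u. \<Sum>i\<in>I. f i u)"
  unfolding lip_bound_def
proof (intro allI)
  fix u v
  have "norm ((\<Sum>i\<in>I. f i u) - (\<Sum>i\<in>I. f i v)) \<le> (\<Sum>i\<in>I. norm (f i u - f i v))"
    unfolding sum_subtractf[symmetric] by (rule norm_sum)
  also have "\<dots> \<le> (\<Sum>i\<in>I. L i * dt u v)"
    by (intro sum_mono lip_boundD assms)
  finally show "norm ((\<Sum>i\<in>I. f i u) - (\<Sum>i\<in>I. f i v)) \<le> (\<Sum>i\<in>I. L i) * dt u v"
    by (simp add: sum_distrib_right)
qed

lemma lip_bound_mono: "lip_bound L f \<Longrightarrow> L \<le> L' \<Longrightarrow> lip_bound L' f"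
  unfolding lip_bound_def by (meson dt_nonneg mult_right_mono order_trans)

lemma first_moment_kernel_iter:
  assumes P: "markov_kernel P" and lyap: "lyapunov_bound P V \<kappa> K"
  shows "first_moment (kernel_iter P k u)"
proof -
  note it = kernel_iter_markov_kernel[OF P]
  have "(\<integral>\<^sup>+v. ennreal (V v) \<partial>kernel_iter P k u) < \<infinity>"
  proof (induction k)
    case 0
    then show ?case by (simp add: nn_integral_return)
  next
    case (Suc k)
    interpret prob_space "kernel_iter P k u" by (rule markov_kernelD[OF it])
    note s[measurable_cong] = markov_kernelD(2)[OF it, of k u]
    have "(\<integral>\<^sup>+v. ennreal (V v) \<partial>kernel_iter P (Suc k) u) = (\<integral>\<^sup>+x. \<integral>\<^sup>+v. ennreal (V v) \<partial>P x \<partial>kernel_iter P k u)"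
      using markov_kernelD(3)[OF P] by (simp, intro nn_integral_bind[where B=borel]) (auto simp: measurable_cong_sets[OF s refl])
    also have "\<dots> \<le> (\<integral>\<^sup>+x. ennreal \<kappa> * ennreal (V x) + ennreal K \<partial>kernel_iter P k u)"
      using lyapunov_boundD[OF lyap] V_nonneg
      by (intro nn_integral_mono) (simp add: ennreal_mult' ennreal_plus less_imp_le)
    also have "\<dots> = ennreal \<kappa> * (\<integral>\<^sup>+x. ennreal (V x) \<partial>kernel_iter P k u) + ennreal K"
      by (simp add: nn_integral_add nn_integral_cmult emeasure_space_1)
    also have "\<dots> < \<infinity>"
      using Suc by (simp add: ennreal_mult_less_top)
    finally show ?case .
  qed
  then show ?thesis by (intro first_momentI markov_kernelD[OF it])
qed

end

locale lipschitz_kernel = weighted_distance d V \<theta>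
  for d :: "'h::{second_countable_topology, zero} \<Rightarrow> 'h \<Rightarrow> real" and V \<theta> +
  fixes P0 :: "'h \<Rightarrow> 'h measure" and \<kappa>0 K0 \<eta> :: real
  assumes P0: "markov_kernel P0" and lyap0: "lyapunov_bound P0 V \<kappa>0 K0"
    and \<eta>: "0 \<le> \<eta>" and step: "u \<noteq> v \<Longrightarrow> wass dt (P0 u) (P0 v) \<le> ennreal (\<eta> * dt u v)"
begin

lemma kernel_op_iter_lip:
  fixes f :: "'h \<Rightarrow> 'x::{banach, second_countable_topology}"
  assumes f: "lip_bound L f" "0 \<le> L" "f \<in> borel_measurable borel"
  shows "lip_bound (\<eta> ^ k * L) ((kernel_op P0 ^^ k) f)"
    and "(kernel_op P0 ^^ k) f \<in> borel_measurable borel"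
proof -
  show m: "(kernel_op P0 ^^ k) f \<in> borel_measurable borel" for k
    using f(3) by (induction k) (auto intro: kernel_op_measurable[OF P0])
  show "lip_bound (\<eta> ^ k * L) ((kernel_op P0 ^^ k) f)"
  proof (induction k)
    case (Suc k)
    then have "lip_bound (\<eta> * (\<eta> ^ k * L)) (kernel_op P0 ((kernel_op P0 ^^ k) f))"
      using \<eta> f(2) by (intro lip_bound_kernel_op lyapunov_first_moment[OF P0 lyap0] step m) auto
    then show ?case by (simp add: mult_ac)
  qed (use f in simp)
qed

text \<open>Links the two ways of iterating: Lipschitz constants are propagated through powers of the operator, whereas the
\<open>n0\<close>-step contraction is a property of the iterated kernel.\<close>
lemma kernel_op_iter_eq:
  fixes f :: "'h \<Rightarrow> 'x::{real_inner, banach, second_countable_topology}"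
  assumes "lip_bound L f" "0 \<le> L" "f \<in> borel_measurable borel"
  shows "(kernel_op P0 ^^ k) f = kernel_op (kernel_iter P0 k) f"
  using assms
proof (induction k arbitrary: f L)
  case 0
  then show ?case by (simp add: kernel_op_def fun_eq_iff integral_return)
next
  case (Suc k)
  note it = kernel_iter_markov_kernel[OF P0]
  have l: "lip_bound (\<eta> * L) (kernel_op P0 f)" and m: "kernel_op P0 f \<in> borel_measurable borel"
    using kernel_op_iter_lip[OF Suc.prems, of 1] by simp_all
  have "kernel_op (kernel_iter P0 (Suc k)) f u = kernel_op (kernel_iter P0 k) (kernel_op P0 f) u" for u
  proof -
    note s = markov_kernelD(2)[OF it, of k u]
    interpret prob_space "kernel_iter P0 k u" by (rule markov_kernelD[OF it])
    have "P0 \<in> kernel_iter P0 k u \<rightarrow>\<^sub>M subprob_algebra borel"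
      using markov_kernelD(3)[OF P0] by (simp add: measurable_cong_sets[OF s refl])
    then show ?thesis
      unfolding kernel_op_def kernel_iter.simps
      using not_empty integrable_lip_bound[OF lyapunov_first_moment[OF P0 lyap0] Suc.prems]
        integrable_lip_bound[OF first_moment_kernel_iter[OF P0 lyap0, of "Suc k" u] Suc.prems]
      by (intro integral_bind_inner[where N = borel] Suc.prems) auto
  qed
  moreover have "(kernel_op P0 ^^ Suc k) f = (kernel_op P0 ^^ k) (kernel_op P0 f)"
    by (simp add: funpow_swap1)
  ultimately show ?case
    using Suc.IH[OF l _ m] \<eta> Suc.prems(2) by (simp add: fun_eq_iff del: kernel_iter.simps funpow.simps)
qed

end

locale mixing_kernel = lipschitz_kernel d V \<theta> P0 \<kappa>0 K0 \<eta>
  for d :: "'h::{second_countable_topology, zero} \<Rightarrow> 'h \<Rightarrow> real" and V \<theta> P0 \<kappa>0 K0 \<eta> +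
  fixes n0 :: nat and \<gamma> G :: real and \<nu>0 :: "'h measure"
  assumes contr: "wass dt (kernel_iter P0 n0 u) (kernel_iter P0 n0 v) \<le> ennreal (\<gamma> * dt u v)"
    and \<gamma>: "0 < \<gamma>" "\<gamma> < 1"
    and G: "0 < G" and quasi: "dt u v \<le> G * (dt u w + dt w v)"
    and \<nu>0: "first_moment \<nu>0" and inv: "invariant_measure P0 \<nu>0"
begin

lemma kernel_op_block_lip:
  fixes f :: "'h \<Rightarrow> 'x::{real_inner, banach, second_countable_topology}"
  assumes f: "lip_bound L f" "0 \<le> L" "f \<in> borel_measurable borel"
  shows "lip_bound (\<gamma> ^ i * (\<eta> ^ j * L)) ((kernel_op P0 ^^ (i * n0 + j)) f)"
proof (induction i)
  case 0
  then show ?case using kernel_op_iter_lip(1)[OF f] by simp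
next
  case (Suc i)
  let ?g = "(kernel_op P0 ^^ (i * n0 + j)) f" and ?L = "\<gamma> ^ i * (\<eta> ^ j * L)"
  have L: "0 \<le> ?L" using \<gamma> \<eta> f by simp
  have gm: "?g \<in> borel_measurable borel" by (rule kernel_op_iter_lip(2)[OF f])
  have "(kernel_op P0 ^^ (Suc i * n0 + j)) f = (kernel_op P0 ^^ n0) ?g"
    by (simp add: funpow_add add.assoc)
  also have "\<dots> = kernel_op (kernel_iter P0 n0) ?g"
    by (rule kernel_op_iter_eq[OF Suc L gm])
  finally show ?case
    using lip_bound_kernel_op[OF first_moment_kernel_iter[OF P0 lyap0] contr _ Suc L gm] \<gamma>
    by (simp add: mult.assoc)
qed

lemma integral_kernel_op_iter_invariant:
  fixes f :: "'h \<Rightarrow> 'x::{real_inner, banach, second_countable_topology}"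
  assumes f: "lip_bound L f" "0 \<le> L" "f \<in> borel_measurable borel"
  shows "(\<integral>u. (kernel_op P0 ^^ k) f u \<partial>\<nu>0) = (\<integral>u. f u \<partial>\<nu>0)"
proof (induction k)
  case (Suc k)
  let ?g = "(kernel_op P0 ^^ k) f"
  have g: "lip_bound (\<eta> ^ k * L) ?g" "0 \<le> \<eta> ^ k * L" "?g \<in> borel_measurable borel"
    using kernel_op_iter_lip[OF f] \<eta> f(2) by auto
  have s: "sets \<nu>0 = sets borel" and inv': "bind \<nu>0 P0 = \<nu>0" and "prob_space \<nu>0"
    using \<nu>0 inv unfolding first_moment_def invariant_measure_def by auto
  interpret prob_space \<nu>0 by fact
  have "P0 \<in> \<nu>0 \<rightarrow>\<^sub>M subprob_algebra borel"
    using markov_kernelD(3)[OF P0] by (simp add: measurable_cong_sets[OF s refl])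
  then have "(\<integral>u. ?g u \<partial>bind \<nu>0 P0) = (\<integral>u. \<integral>y. ?g y \<partial>P0 u \<partial>\<nu>0)"
    using not_empty integrable_lip_bound[OF lyapunov_first_moment[OF P0 lyap0] g]
      integrable_lip_bound[OF \<nu>0 g]
    by (intro integral_bind_inner[where N = borel] g) (auto simp: inv')
  then show ?case using Suc by (simp add: inv' kernel_op_def[of P0 ?g])
qed simp

definition mean_dt :: real where "mean_dt = enn2real (\<integral>\<^sup>+u. ennreal (dt u 0) \<partial>\<nu>0)"

text \<open>By invariance \<open>\<nu>0(f)\<close> is the \<open>\<nu>0\<close>-mean of \<open>P0^(m * n0) f\<close>, a function with Lipschitz constant
\<open>\<gamma>^m * L\<close>; so the difference is at most \<open>\<gamma>^m * L\<close> times the \<open>\<nu>0\<close>-mean of \<open>dt u\<close>. The weak triangle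
inequality bounds this mean by \<open>G * (dt u 0 + mean_dt)\<close>; since the factor \<open>\<gamma>^m\<close> tends to zero, \<open>G\<close> leaves no
trace in the final estimates.\<close>
lemma kernel_op_iter_mixing:
  fixes f :: "'h \<Rightarrow> 'x::{real_inner, banach, second_countable_topology}"
  assumes f: "lip_bound L f" "0 \<le> L" "f \<in> borel_measurable borel"
  shows "norm ((kernel_op P0 ^^ (m * n0)) f u - (\<integral>v. f v \<partial>\<nu>0)) \<le> \<gamma> ^ m * L * (G * (dt u 0 + mean_dt))"
proof -
  let ?g = "(kernel_op P0 ^^ (m * n0)) f"
  have g: "lip_bound (\<gamma> ^ m * L) ?g" "0 \<le> \<gamma> ^ m * L" "?g \<in> borel_measurable borel"
    using kernel_op_block_lip[OF f, of m 0] kernel_op_iter_lip(2)[OF f] \<gamma> f(2) by auto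
  have s[measurable_cong]: "sets \<nu>0 = sets borel" and "prob_space \<nu>0" and fin: "(\<integral>\<^sup>+u. ennreal (dt u 0) \<partial>\<nu>0) < \<infinity>"
    using \<nu>0 unfolding first_moment_def by auto
  interpret prob_space \<nu>0 by fact
  have [measurable]: "(\<lambda>v. dt v 0) \<in> borel_measurable borel"
    using measurable_compose[OF measurable_Pair[of "\<lambda>v. v" borel borel "\<lambda>_. 0" borel] dt_measurable] by simp
  have "(\<integral>\<^sup>+v. ennreal (dt u v) \<partial>\<nu>0) \<le> (\<integral>\<^sup>+v. ennreal G * (ennreal (dt u 0) + ennreal (dt v 0)) \<partial>\<nu>0)"
    using quasi[of u _ 0] G dt_nonneg dt_sym
    by (intro nn_integral_mono) (simp flip: ennreal_plus ennreal_mult' add: ennreal_leI)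
  also have "\<dots> = ennreal G * (ennreal (dt u 0) + (\<integral>\<^sup>+v. ennreal (dt v 0) \<partial>\<nu>0))"
    by (simp add: nn_integral_add nn_integral_cmult emeasure_space_1)
  also have "\<dots> = ennreal (G * (dt u 0 + mean_dt))"
    using fin G dt_nonneg unfolding mean_dt_def by (simp add: ennreal_mult' ennreal_plus)
  finally have "norm ((\<integral>v. ?g u \<partial>\<nu>0) - (\<integral>v. ?g v \<partial>\<nu>0)) \<le> \<gamma> ^ m * L * (G * (dt u 0 + mean_dt))"
    using integrable_lip_bound[OF \<nu>0 g] G dt_nonneg
    by (intro norm_integral_lip_le(2)[OF g(1,2)]) (auto simp: mean_dt_def)
  then show ?thesis
    unfolding integral_kernel_op_iter_invariant[OF f] by (simp add: prob_space)
qed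

text \<open>The truncated Neumann series for \<open>(I - P0)^(-1)\<close>. The truncation at multiples of \<open>n0\<close> lets whole contraction
blocks be summed.\<close>
definition corrector :: "('h \<Rightarrow> 'x::{real_inner, banach, second_countable_topology}) \<Rightarrow> nat \<Rightarrow> 'h \<Rightarrow> 'x" where
  "corrector f m u = (\<Sum>k<m * n0. (kernel_op P0 ^^ k) f u)"

text \<open>Writing \<open>k = i * n0 + j\<close> with \<open>j < n0\<close>, the \<open>k\<close>-th term has Lipschitz constant
\<open>\<gamma>^i * \<eta>^j * L\<close>; the sum over \<open>i\<close> gives \<open>1 / (1 - \<gamma>)\<close>, independently of \<open>m\<close>.\<close>
lemma corrector_lip:
  fixes f :: "'h \<Rightarrow> 'x::{real_inner, banach, second_countable_topology}"
  assumes f: "lip_bound L f" "0 \<le> L" "f \<in> borel_measurable borel"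
  shows "lip_bound ((\<Sum>j<n0. \<eta> ^ j) * L / (1 - \<gamma>)) (corrector f m)"
    and "corrector f m \<in> borel_measurable borel"
proof -
  let ?S = "\<Sum>j<n0. \<eta> ^ j"
  have eq: "corrector f m = (\<lambda>u. \<Sum>i<m. \<Sum>j<n0. (kernel_op P0 ^^ (i * n0 + j)) f u)"
    unfolding corrector_def fun_eq_iff
    by (simp add: sum.nat_group[symmetric] sum.shift_bounds_nat_ivl[of _ 0, simplified] atLeast0LessThan add.commute)
  have "lip_bound (\<Sum>i<m. \<Sum>j<n0. \<gamma> ^ i * (\<eta> ^ j * L)) (corrector f m)"
    unfolding eq by (intro lip_bound_sum kernel_op_block_lip f)
  also have "(\<Sum>i<m. \<Sum>j<n0. \<gamma> ^ i * (\<eta> ^ j * L)) = (\<Sum>i<m. \<gamma> ^ i) * (?S * L)"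
    unfolding sum_distrib_left[symmetric] sum_distrib_right[symmetric] ..
  finally show "lip_bound (?S * L / (1 - \<gamma>)) (corrector f m)"
  proof (rule lip_bound_mono)
    have "(\<Sum>i<m. \<gamma> ^ i) \<le> (\<Sum>i. \<gamma> ^ i)"
      using \<gamma> by (intro sum_le_suminf summable_geometric) auto
    then have "(\<Sum>i<m. \<gamma> ^ i) \<le> 1 / (1 - \<gamma>)"
      using \<gamma> by (simp add: suminf_geometric)
    moreover have "0 \<le> ?S * L" using \<eta> f(2) by (simp add: sum_nonneg)
    ultimately show "(\<Sum>i<m. \<gamma> ^ i) * (?S * L) \<le> ?S * L / (1 - \<gamma>)"
      using mult_right_mono by fastforce
  qed
  show "corrector f m \<in> borel_measurable borel"
    unfolding corrector_def using kernel_op_iter_lip(2)[OF f] by (intro borel_measurable_sum)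
qed

lemma corrector_poisson:
  fixes f :: "'h \<Rightarrow> 'x::{real_inner, banach, second_countable_topology}"
  assumes f: "lip_bound L f" "0 \<le> L" "f \<in> borel_measurable borel"
  shows "f u = corrector f m u - kernel_op P0 (corrector f m) u + (kernel_op P0 ^^ (m * n0)) f u"
proof -
  have i: "integrable (P0 u) ((kernel_op P0 ^^ k) f)" for k
    using \<eta> f(2) by (intro integrable_lip_bound[OF lyapunov_first_moment[OF P0 lyap0] kernel_op_iter_lip(1)[OF f] _
      kernel_op_iter_lip(2)[OF f]]) auto
  have "kernel_op P0 (corrector f m) u = (\<Sum>k<m * n0. (kernel_op P0 ^^ Suc k) f u)"
    unfolding corrector_def kernel_op_def[of P0 _ u] using i by (simp add: kernel_op_def)
  then have "corrector f m u - kernel_op P0 (corrector f m) u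
      = (\<Sum>k<m * n0. (kernel_op P0 ^^ k) f u - (kernel_op P0 ^^ Suc k) f u)"
    unfolding corrector_def by (simp add: sum_subtractf)
  also have "\<dots> = f u - (kernel_op P0 ^^ (m * n0)) f u"
    using sum_lessThan_telescope'[of "\<lambda>k. (kernel_op P0 ^^ k) f u" "m * n0"] by simp
  finally show ?thesis by simp
qed

end

section \<open>Ergodic averages of a perturbed chain\<close>

locale perturbed_chain =
  mixing_kernel d V \<theta> P0 \<kappa>0 K0 \<eta> n0 \<gamma> G \<nu>0 + lyapunov_chain d V \<theta> P \<kappa> K M U u0
  for d :: "'h::{second_countable_topology, zero} \<Rightarrow> 'h \<Rightarrow> real" and V \<theta> P0 \<kappa>0 K0 \<eta> n0 \<gamma> G \<nu>0
    and P \<kappa> K and M :: "'w measure" and U u0 +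
  fixes q :: real
  assumes q: "0 \<le> q" and pert: "wass dt (P0 u) (P u) \<le> ennreal (q * (1 + sqrt (V u)))"
begin

text \<open>The estimates for the corrector with parameter \<open>m\<close> carry an error \<open>\<gamma>^m * C\<close>, where \<open>C\<close> does not
depend on \<open>m\<close>; the remaining bounds are uniform in \<open>m\<close>, so the error vanishes in the limit.\<close>
lemma perturbed_ergodic_average_le:
  fixes f :: "'h \<Rightarrow> 'x::{real_inner, banach, second_countable_topology}"
  assumes f: "lip_bound L f" "0 \<le> L" "f \<in> borel_measurable borel" and n: "1 \<le> n"
  defines "A \<equiv> \<lambda>\<omega>. (1 / real n) *\<^sub>R (\<Sum>k<n. f (U k \<omega>))"
    and "\<Lambda> \<equiv> (\<Sum>j<n0. \<eta> ^ j) * L / (1 - \<gamma>)"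
  shows "expectation (\<lambda>\<omega>. norm (A \<omega> - (\<integral>u. f u \<partial>\<nu>0))) \<le>
      \<Lambda> * (q * (1 + sqrt (K / (1 - \<kappa>))) + (q * (sqrt (V u0) / (1 - sqrt \<kappa>)) + dt_scale) / n + dt_scale / sqrt n)"
      (is "?a \<le> ?A")
    and "norm (expectation A - (\<integral>u. f u \<partial>\<nu>0)) \<le>
      \<Lambda> * (q * (1 + sqrt (K / (1 - \<kappa>))) + (q * (sqrt (V u0) / (1 - sqrt \<kappa>)) + dt_scale) / n)"
      (is "?b \<le> ?B")
proof -
  define C where "C = L * (G * (sqrt (2 + \<theta> * V_sup + \<theta> * V 0) + mean_dt))"
  have \<Lambda>: "0 \<le> \<Lambda>"
    unfolding \<Lambda>_def using \<eta> f(2) \<gamma> by (simp add: sum_nonneg)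
  have bounds: "?a \<le> ?A + \<gamma> ^ m * C \<and> ?b \<le> ?B + \<gamma> ^ m * C" for m
  proof -
    let ?F = "corrector f m"
    let ?R = "\<lambda>u. (kernel_op P0 ^^ (m * n0)) f u - (\<integral>v. f v \<partial>\<nu>0)"
    note F = corrector_lip[OF f, of m, folded \<Lambda>_def]
    have decomp: "f u - (\<integral>v. f v \<partial>\<nu>0) = ?F u - kernel_op P0 ?F u + ?R u" for u
      using corrector_poisson[OF f, of u m] by simp
    have H: "norm (kernel_op P ?F u - kernel_op P0 ?F u) \<le> \<Lambda> * q * (1 + sqrt (V u))" for u
    proof -
      have "norm (kernel_op P0 ?F u - kernel_op P ?F u) \<le> \<Lambda> * (q * (1 + sqrt (V u)))"
        unfolding kernel_op_def using q V_nonneg[of u]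
        by (intro norm_integral_diff_le_wass[OF F(1) \<Lambda> F(2)] pert
            integrable_lip_bound[OF lyapunov_first_moment[OF P0 lyap0] F(1) \<Lambda> F(2)]
            integrable_lip_bound[OF lyapunov_first_moment[OF P lyap] F(1) \<Lambda> F(2)]) simp
      then show ?thesis by (simp add: norm_minus_commute mult.assoc)
    qed
    have Ri: "integrable M (\<lambda>\<omega>. ?R (U k \<omega>))" for k
      using kernel_op_iter_lip[OF f] \<eta> f(2)
      by (intro Bochner_Integration.integrable_diff integrable_const integrable_lip_chain[of "\<eta> ^ (m * n0) * L"]) auto
    have Rb: "expectation (\<lambda>\<omega>. norm (?R (U k \<omega>))) \<le> \<gamma> ^ m * C" for k
    proof -
      have "expectation (\<lambda>\<omega>. norm (?R (U k \<omega>))) \<le> expectation (\<lambda>\<omega>. \<gamma> ^ m * L * (G * (dt (U k \<omega>) 0 + mean_dt)))"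
        using Ri expectation_dt_le(1) by (intro integral_mono kernel_op_iter_mixing[OF f]) auto
      also have "\<dots> = \<gamma> ^ m * L * (G * (expectation (\<lambda>\<omega>. dt (U k \<omega>) 0) + mean_dt))"
        using expectation_dt_le(1) by (simp add: prob_space)
      also have "\<dots> \<le> \<gamma> ^ m * L * (G * (sqrt (2 + \<theta> * V_sup + \<theta> * V 0) + mean_dt))"
        using \<gamma> f(2) G expectation_dt_le(2) by (intro mult_left_mono add_right_mono) auto
      finally show ?thesis by (simp add: C_def mult.assoc)
    qed
    have "kernel_op P0 ?F \<in> borel_measurable borel"
      by (rule kernel_op_measurable[OF P0 F(2)])
    from ergodic_average_le[OF F(1) \<Lambda> F(2) decomp H q this integrable_lip_chain[OF f] Ri Rb n]
    show ?thesis unfolding A_def by blast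
  qed
  have lim: "(\<lambda>m. X + \<gamma> ^ m * C) \<longlonglongrightarrow> X" for X
  proof -
    have "(\<lambda>m. X + \<gamma> ^ m * C) \<longlonglongrightarrow> X + 0 * C"
      using \<gamma> by (intro tendsto_intros LIMSEQ_realpow_zero) auto
    then show ?thesis by simp
  qed
  show "?a \<le> ?A" by (rule LIMSEQ_le_const[OF lim]) (use bounds in blast)
  show "?b \<le> ?B" by (rule LIMSEQ_le_const[OF lim]) (use bounds in blast)
qed

end

text \<open>The corrector has at most this factor, divided by \<open>1 - \<gamma>\<close>, times the Lipschitz constant of \<open>\<phi>\<close>.\<close>
definition corrector_factor :: "nat \<Rightarrow> real \<Rightarrow> real \<Rightarrow> real" where
  "corrector_factor n0 K0 \<theta> = (\<Sum>j<n0. sqrt (1 + \<theta> * K0) ^ j)"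

text \<open>The maximum with \<open>1\<close>, here and below, makes the constants positive for all values of the parameters, including those that no
chain satisfies.\<close>
definition bias_const :: "nat \<Rightarrow> real \<Rightarrow> real \<Rightarrow> real \<Rightarrow> real \<Rightarrow> real" where
  "bias_const n0 K0 \<theta> \<kappa> K = max 1 (corrector_factor n0 K0 \<theta> * (1 + sqrt (K / (1 - \<kappa>))))"

text \<open>Collects everything that vanishes as \<open>n\<close> grows: the transient part of the perturbation error, with the a
priori perturbation size of \<open>wass_dt_le_of_lyapunov\<close>, and \<open>r\<close> terms of size \<open>dt_scale\<close>. One of them
is the boundary term; the mean absolute error has the martingale term as a second.\<close>
definition decay_const :: "real \<Rightarrow> nat \<Rightarrow> real \<Rightarrow> real \<Rightarrow> real \<Rightarrow> real \<Rightarrow> real \<Rightarrow> real" where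
  "decay_const r n0 K0 \<theta> \<kappa> K v = max 1 (corrector_factor n0 K0 \<theta> *
     ((sqrt (2 + \<theta> * (K0 + K)) + sqrt (2 * \<theta>)) * (sqrt v / (1 - sqrt \<kappa>))
      + r * sqrt (2 + 2 * \<theta> * (v + K / (1 - \<kappa>)))))"

lemma (in weighted_distance) lip_norm_imp_lip_bound:
  assumes "lip_norm dt f < \<infinity>"
  shows "lip_bound (enn2real (lip_norm dt f)) f"
  unfolding lip_bound_def
proof (intro allI)
  fix u v
  show "norm (f u - f v) \<le> enn2real (lip_norm dt f) * dt u v"
  proof (cases "u = v")
    case False
    then have "ennreal (norm (f u - f v) / dt u v) \<le> lip_norm dt f"
      unfolding lip_norm_def by (intro SUP_upper2[of "(u, v)"]) auto
    also have "\<dots> = ennreal (enn2real (lip_norm dt f))"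
      using assms by (simp add: less_top)
    finally have "norm (f u - f v) / dt u v \<le> enn2real (lip_norm dt f)"
      by (subst (asm) ennreal_le_iff) auto
    then show ?thesis using dt_pos[OF False] by (simp add: divide_le_eq)
  qed simp
qed

text \<open>The perturbation size is cut off at the a priori bound, \<open>q = min p c\<close>. In the leading term \<open>q \<le> p\<close> is
used, and in the transient term \<open>q \<le> c\<close>. As a consequence the middle coefficient can be the constant \<open>1\<close>.\<close>
lemma ergodic_bounds:
  fixes d :: "'h::{banach, second_countable_topology} \<Rightarrow> 'h \<Rightarrow> real" and M :: "'w measure"
    and \<phi> :: "'h \<Rightarrow> 'x::{real_inner, banach, second_countable_topology}"
  assumes dl: "distance_like d" "\<And>u v. d u v \<le> 1"
    and V: "continuous_on UNIV V" "\<And>u. 0 \<le> V u" and \<theta>: "0 < \<theta>"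
    and P0: "markov_kernel P0" "lyapunov_bound P0 V \<kappa>0 K0"
    and contr1: "0 < \<gamma>1" "\<gamma>1 < 1" "\<And>u v. d u v < 1 \<Longrightarrow> wass d (P0 u) (P0 v) \<le> ennreal (\<gamma>1 * d u v)"
    and quasi: "0 < G" "\<And>u v w. dtilde d V \<theta> u v \<le> G * (dtilde d V \<theta> u w + dtilde d V \<theta> w v)"
    and \<nu>0: "\<nu>0 \<in> P1 (dtilde d V \<theta>)" "invariant_measure P0 \<nu>0"
    and \<gamma>: "0 < \<gamma>" "\<gamma> < 1"
    and contr: "\<And>u v. wass (dtilde d V \<theta>) (kernel_iter P0 n0 u) (kernel_iter P0 n0 v) \<le> ennreal (\<gamma> * dtilde d V \<theta> u v)"
    and P: "markov_kernel P" "lyapunov_bound P V \<kappa> K"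
    and pert: "0 \<le> p" "\<And>u. wass (dtilde d V \<theta>) (P0 u) (P u) \<le> ennreal (p * (1 + sqrt (V u)))"
    and chain: "markov_chain M U P u0"
    and \<phi>: "\<phi> \<in> borel_measurable borel" "lip_norm (dtilde d V \<theta>) \<phi> < \<infinity>"
  defines "A \<equiv> \<lambda>n \<omega>. (1 / real n) *\<^sub>R (\<Sum>k<n. \<phi> (U k \<omega>))"
    and "\<Lambda> \<equiv> enn2real (lip_norm (dtilde d V \<theta>) \<phi>) / (1 - \<gamma>)"
  shows "integrable \<nu>0 \<phi>" and "integrable M (A n)"
    and "1 \<le> n \<Longrightarrow> (\<integral>\<omega>. norm (A n \<omega> - (\<integral>u. \<phi> u \<partial>\<nu>0)) \<partial>M)
      \<le> \<Lambda> * (bias_const n0 K0 \<theta> \<kappa> K * p + 1 * (p / n) + decay_const 2 n0 K0 \<theta> \<kappa> K (V u0) * (1 / sqrt n))"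
    and "1 \<le> n \<Longrightarrow> norm ((\<integral>\<omega>. A n \<omega> \<partial>M) - (\<integral>u. \<phi> u \<partial>\<nu>0))
      \<le> \<Lambda> * (bias_const n0 K0 \<theta> \<kappa> K * p + 1 * (p / n) + decay_const 1 n0 K0 \<theta> \<kappa> K (V u0) / n)"
proof -
  interpret weighted_distance d V \<theta> by unfold_locales fact+
  define c where "c = sqrt (2 + \<theta> * (K0 + K)) + sqrt (2 * \<theta>)"
  define q where "q = min p c"
  define S where "S = corrector_factor n0 K0 \<theta>"
  define \<beta> where "\<beta> = sqrt (V u0) / (1 - sqrt \<kappa>)"
  define s where "s = sqrt (2 + 2 * \<theta> * (V u0 + K / (1 - \<kappa>)))"
  define L where "L = enn2real (lip_norm dt \<phi>)"
  note k0 = lyapunov_boundD(1-3)[OF P0(2)] and k = lyapunov_boundD(1-3)[OF P(2)]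
  have c: "0 \<le> c" unfolding c_def using \<theta> k0 k by simp
  have qb: "0 \<le> q" "q \<le> p" "q \<le> c" unfolding q_def using c pert(1) by auto
  have p: "0 \<le> p / n" using pert(1) by simp
  have S: "0 \<le> S" unfolding S_def corrector_factor_def using \<theta> k0 by (intro sum_nonneg) simp
  have \<beta>: "0 \<le> \<beta>" unfolding \<beta>_def using k V(2) by simp
  have s: "0 \<le> s" unfolding s_def using \<theta> k V(2)[of u0] by simp
  have L: "0 \<le> L" unfolding L_def by simp
  have \<Lambda>: "0 \<le> \<Lambda>" unfolding \<Lambda>_def using \<gamma> by simp
  have lip: "lip_bound L \<phi>" unfolding L_def by (rule lip_norm_imp_lip_bound[OF \<phi>(2)])
  interpret perturbed_chain d V \<theta> P0 \<kappa>0 K0 "sqrt (1 + \<theta> * K0)" n0 \<gamma> G \<nu>0 P \<kappa> K M U u0 q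
  proof unfold_locales
    show "wass dt (P0 u) (P0 v) \<le> ennreal (sqrt (1 + \<theta> * K0) * dt u v)" if "u \<noteq> v" for u v
      using that by (intro wass_contraction_imp_dt_lipschitz[OF P0 contr1(3,1,2)])
    show "wass dt (P0 u) (P u) \<le> ennreal (q * (1 + sqrt (V u)))" for u
      using pert(2) wass_dt_le_of_lyapunov[OF P0 P] unfolding q_def c_def by (auto simp: min_def)
    show "first_moment \<nu>0"
      using \<nu>0(1) unfolding first_moment_def P1_def radon_prob_def by simp
  qed (use P0 P chain contr \<gamma> quasi \<nu>0 qb \<theta> k0 in auto)
  have ss: "dt_scale = s" unfolding dt_scale_def s_def V_sup_def ..
  show "integrable \<nu>0 \<phi>"
    by (rule integrable_lip_bound[OF \<nu>0 lip L \<phi>(1)])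
  show "integrable M (A n)"
    unfolding A_def using integrable_lip_chain[OF lip L \<phi>(1)] by simp
  have \<Lambda>S: "(\<Sum>j<n0. sqrt (1 + \<theta> * K0) ^ j) * L / (1 - \<gamma>) = \<Lambda> * S"
    unfolding S_def corrector_factor_def \<Lambda>_def L_def by simp
  note bnd = perturbed_ergodic_average_le[OF lip L \<phi>(1), of n, unfolded \<Lambda>S ss, folded \<beta>_def]
  have bias: "S * (q * (1 + sqrt (K / (1 - \<kappa>)))) \<le> bias_const n0 K0 \<theta> \<kappa> K * p"
  proof -
    have "S * (q * (1 + sqrt (K / (1 - \<kappa>)))) = S * (1 + sqrt (K / (1 - \<kappa>))) * q" by simp
    also have "\<dots> \<le> bias_const n0 K0 \<theta> \<kappa> K * p"
      unfolding bias_const_def S_def by (intro mult_mono) (use qb in auto)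
    finally show ?thesis .
  qed
  have decay: "S * (q * \<beta> + r * s) \<le> decay_const r n0 K0 \<theta> \<kappa> K (V u0)" for r
  proof -
    have "S * (q * \<beta> + r * s) \<le> S * (c * \<beta> + r * s)"
      using S \<beta> qb by (intro mult_left_mono add_right_mono mult_right_mono) auto
    then show ?thesis unfolding decay_const_def S_def c_def \<beta>_def s_def by simp
  qed
  {
    assume n: "1 \<le> n"
    have "S * (q * (1 + sqrt (K / (1 - \<kappa>))) + (q * \<beta> + s) / n)
        = S * (q * (1 + sqrt (K / (1 - \<kappa>)))) + S * (q * \<beta> + 1 * s) / n"
      by (simp add: distrib_left)
    also have "\<dots> \<le> bias_const n0 K0 \<theta> \<kappa> K * p + decay_const 1 n0 K0 \<theta> \<kappa> K (V u0) / n"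
      by (intro add_mono bias divide_right_mono decay) simp
    finally have "S * (q * (1 + sqrt (K / (1 - \<kappa>))) + (q * \<beta> + s) / n)
      \<le> bias_const n0 K0 \<theta> \<kappa> K * p + 1 * (p / n) + decay_const 1 n0 K0 \<theta> \<kappa> K (V u0) / n"
      using p by linarith
    from order_trans[OF bnd(2)[OF n, unfolded mult.assoc] mult_left_mono[OF this \<Lambda>]]
    show "norm ((\<integral>\<omega>. A n \<omega> \<partial>M) - (\<integral>u. \<phi> u \<partial>\<nu>0))
      \<le> \<Lambda> * (bias_const n0 K0 \<theta> \<kappa> K * p + 1 * (p / n) + decay_const 1 n0 K0 \<theta> \<kappa> K (V u0) / n)"
      unfolding A_def .
    \<comment> \<open>In the mean absolute error, the terms of order \<open>1 / n\<close> are absorbed into \<open>1 / sqrt n\<close>.\<close>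
    have "sqrt n * 1 \<le> sqrt n * sqrt n" using n by (intro mult_left_mono) auto
    then have "sqrt n \<le> n" by simp
    then have "(q * \<beta> + s) / n \<le> (q * \<beta> + s) / sqrt n"
      using n qb \<beta> s by (intro divide_left_mono) auto
    then have "S * (q * (1 + sqrt (K / (1 - \<kappa>))) + (q * \<beta> + s) / n + s / sqrt n)
       \<le> S * (q * (1 + sqrt (K / (1 - \<kappa>))) + (q * \<beta> + s) / sqrt n + s / sqrt n)"
      by (intro mult_left_mono[OF _ S]) simp
    also have "\<dots> = S * (q * (1 + sqrt (K / (1 - \<kappa>)))) + S * (q * \<beta> + 2 * s) * (1 / sqrt n)"
      by (simp add: distrib_left add_divide_distrib)
    also have "\<dots> \<le> bias_const n0 K0 \<theta> \<kappa> K * p + decay_const 2 n0 K0 \<theta> \<kappa> K (V u0) * (1 / sqrt n)"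
      by (intro add_mono bias mult_right_mono decay) simp
    finally have "S * (q * (1 + sqrt (K / (1 - \<kappa>))) + (q * \<beta> + s) / n + s / sqrt n)
      \<le> bias_const n0 K0 \<theta> \<kappa> K * p + 1 * (p / n) + decay_const 2 n0 K0 \<theta> \<kappa> K (V u0) * (1 / sqrt n)"
      using p by linarith
    from order_trans[OF bnd(1)[OF n, unfolded mult.assoc] mult_left_mono[OF this \<Lambda>]]
    show "(\<integral>\<omega>. norm (A n \<omega> - (\<integral>u. \<phi> u \<partial>\<nu>0)) \<partial>M)
      \<le> \<Lambda> * (bias_const n0 K0 \<theta> \<kappa> K * p + 1 * (p / n) + decay_const 2 n0 K0 \<theta> \<kappa> K (V u0) * (1 / sqrt n))"
      unfolding A_def .
  }
qed

theorem theorem5: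
  shows "\<exists>(C1 :: nat \<Rightarrow> real \<Rightarrow> real \<Rightarrow> real \<Rightarrow> real \<Rightarrow> real \<Rightarrow> real \<Rightarrow> real \<Rightarrow> real)
      (C2 :: nat \<Rightarrow> real \<Rightarrow> real \<Rightarrow> real \<Rightarrow> real \<Rightarrow> real \<Rightarrow> real \<Rightarrow> real \<Rightarrow> real)
      (C3 :: nat \<Rightarrow> real \<Rightarrow> real \<Rightarrow> real \<Rightarrow> real \<Rightarrow> real \<Rightarrow> real \<Rightarrow> real \<Rightarrow> real)
      (C4 :: nat \<Rightarrow> real \<Rightarrow> real \<Rightarrow> real \<Rightarrow> real \<Rightarrow> real \<Rightarrow> real)
      (C5 :: nat \<Rightarrow> real \<Rightarrow> real \<Rightarrow> real \<Rightarrow> real \<Rightarrow> real \<Rightarrow> real)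
      (C6 :: nat \<Rightarrow> real \<Rightarrow> real \<Rightarrow> real \<Rightarrow> real \<Rightarrow> real \<Rightarrow> real \<Rightarrow> real).
    (\<forall>n0 \<kappa>0 K0 \<theta> \<kappa> K \<gamma> v.
       0 < C1 n0 \<kappa>0 K0 \<theta> \<kappa> K \<gamma> v \<and> 0 < C2 n0 \<kappa>0 K0 \<theta> \<kappa> K \<gamma> v \<and> 0 < C3 n0 \<kappa>0 K0 \<theta> \<kappa> K \<gamma> v \<and>
       0 < C4 n0 \<kappa>0 K0 \<theta> \<kappa> K \<and> 0 < C5 n0 \<kappa>0 K0 \<theta> \<kappa> K \<and> 0 < C6 n0 \<kappa>0 K0 \<theta> \<kappa> K v) \<and>
    (\<forall>(d :: 'h::{banach, second_countable_topology} \<Rightarrow> 'h \<Rightarrow> real) (P0 :: 'h \<Rightarrow> 'h measure)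
       (V :: 'h \<Rightarrow> real) (\<nu>0 :: 'h measure) (\<gamma>1 :: real) (\<kappa>0 :: real) (K0 :: real) (\<theta> :: real)
       (G :: real) (n0 :: nat) (\<gamma> :: real) (\<epsilon>0 :: real) (P :: real \<Rightarrow> 'h \<Rightarrow> 'h measure)
       (\<kappa> :: real \<Rightarrow> real) (K :: real \<Rightarrow> real) (\<psi> :: real \<Rightarrow> real) (u0 :: 'h) (\<epsilon> :: real)
       (M :: 'w measure) (U :: nat \<Rightarrow> 'w \<Rightarrow> 'h)
       (\<phi> :: 'h \<Rightarrow> 'x::{real_inner, banach, second_countable_topology}).
      markov_kernel P0 \<and>
      distance_like d \<and> (\<forall>u v. d u v \<le> 1) \<and>
      0 < \<gamma>1 \<and> \<gamma>1 < 1 \<and> (\<forall>u v. d u v < 1 \<longrightarrow> wass d (P0 u) (P0 v) \<le> ennreal (\<gamma>1 * d u v)) \<and>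
      continuous_on UNIV V \<and> (\<forall>u. 0 \<le> V u) \<and> lyapunov_bound P0 V \<kappa>0 K0 \<and>
      0 < \<theta> \<and> 0 < G \<and>
      (\<forall>u v w. dtilde d V \<theta> u v \<le> G * (dtilde d V \<theta> u w + dtilde d V \<theta> w v)) \<and>
      \<nu>0 \<in> P1 (dtilde d V \<theta>) \<and> invariant_measure P0 \<nu>0 \<and>
      (\<forall>\<nu>\<in>P1 (dtilde d V \<theta>). invariant_measure P0 \<nu> \<longrightarrow> \<nu> = \<nu>0) \<and>
      1 \<le> n0 \<and> 0 < \<gamma> \<and> \<gamma> < 1 \<and>
      (\<forall>u v. wass (dtilde d V \<theta>) (kernel_iter P0 n0 u) (kernel_iter P0 n0 v)
               \<le> ennreal (\<gamma> * dtilde d V \<theta> u v)) \<and>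
      0 < \<epsilon>0 \<and> (\<forall>e\<in>{0<..<\<epsilon>0}. markov_kernel (P e)) \<and>
      (\<forall>e\<in>{0<..<\<epsilon>0}. lyapunov_bound (P e) V (\<kappa> e) (K e)) \<and>
      (\<forall>e\<in>{0..}. 0 \<le> \<psi> e) \<and> bounded (\<psi> ` {0..}) \<and>
      (\<forall>u. \<forall>e\<in>{0<..<\<epsilon>0}.
         wass (dtilde d V \<theta>) (P0 u) (P e u) \<le> ennreal (\<psi> e * (1 + sqrt (V u)))) \<and>
      \<epsilon> \<in> {0<..<\<epsilon>0} \<and> markov_chain M U (P \<epsilon>) u0 \<and>
      \<phi> \<in> borel_measurable borel \<and> lip_norm (dtilde d V \<theta>) \<phi> < \<infinity>
      \<longrightarrow>
      integrable \<nu>0 \<phi> \<and>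
      (\<forall>n\<ge>1.
         integrable M (\<lambda>\<omega>. (1 / real n) *\<^sub>R (\<Sum>k<n. \<phi> (U k \<omega>))) \<and>
         (\<integral>\<omega>. norm ((1 / real n) *\<^sub>R (\<Sum>k<n. \<phi> (U k \<omega>)) - (\<integral>u. \<phi> u \<partial>\<nu>0)) \<partial>M)
           \<le> enn2real (lip_norm (dtilde d V \<theta>) \<phi>) / (1 - \<gamma>) *
               (C1 n0 \<kappa>0 K0 \<theta> (\<kappa> \<epsilon>) (K \<epsilon>) \<gamma> (V u0) * \<psi> \<epsilon>
                + C2 n0 \<kappa>0 K0 \<theta> (\<kappa> \<epsilon>) (K \<epsilon>) \<gamma> (V u0) * (\<psi> \<epsilon> / real n)
                + C3 n0 \<kappa>0 K0 \<theta> (\<kappa> \<epsilon>) (K \<epsilon>) \<gamma> (V u0) * (1 / sqrt (real n))) \<and>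
         norm ((\<integral>\<omega>. (1 / real n) *\<^sub>R (\<Sum>k<n. \<phi> (U k \<omega>)) \<partial>M) - (\<integral>u. \<phi> u \<partial>\<nu>0))
           \<le> enn2real (lip_norm (dtilde d V \<theta>) \<phi>) / (1 - \<gamma>) *
               (C4 n0 \<kappa>0 K0 \<theta> (\<kappa> \<epsilon>) (K \<epsilon>) * \<psi> \<epsilon>
                + C5 n0 \<kappa>0 K0 \<theta> (\<kappa> \<epsilon>) (K \<epsilon>) * (\<psi> \<epsilon> / real n)
                + C6 n0 \<kappa>0 K0 \<theta> (\<kappa> \<epsilon>) (K \<epsilon>) (V u0) / real n)))"
proof (rule exI[of _ "\<lambda>n0 \<kappa>0 K0 \<theta> \<kappa> K \<gamma> v. bias_const n0 K0 \<theta> \<kappa> K"],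
    rule exI[of _ "\<lambda>n0 \<kappa>0 K0 \<theta> \<kappa> K \<gamma> v. 1"],
    rule exI[of _ "\<lambda>n0 \<kappa>0 K0 \<theta> \<kappa> K \<gamma> v. decay_const 2 n0 K0 \<theta> \<kappa> K v"],
    rule exI[of _ "\<lambda>n0 \<kappa>0 K0 \<theta> \<kappa> K. bias_const n0 K0 \<theta> \<kappa> K"],
    rule exI[of _ "\<lambda>n0 \<kappa>0 K0 \<theta> \<kappa> K. 1"],
    rule exI[of _ "\<lambda>n0 \<kappa>0 K0 \<theta> \<kappa> K v. decay_const 1 n0 K0 \<theta> \<kappa> K v"],
    rule conjI, goal_cases)
  case 1
  then show ?case
    by (simp add: bias_const_def decay_const_def less_max_iff_disj)
next
  case 2
  show ?case
  proof (intro allI impI, elim conjE, goal_cases)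
    case (1 d P0 V \<nu>0 \<gamma>1 \<kappa>0 K0 \<theta> G n0 \<gamma> \<epsilon>0 P \<kappa> K \<psi> u0 \<epsilon> M U \<phi>)
    have \<psi>: "0 \<le> \<psi> \<epsilon>" using 1 by simp
    note bounds = ergodic_bounds[of d V \<theta> P0 \<kappa>0 K0 \<gamma>1 G \<nu>0 \<gamma> n0 "P \<epsilon>" "\<kappa> \<epsilon>" "K \<epsilon>" "\<psi> \<epsilon>" M U u0 \<phi>]
    show ?case
      by (intro conjI allI impI; rule bounds) (use 1 \<psi> in blast)+
  qed
qed

end
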